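(* Let $\Psi\in C^{1,\alpha_0}(\overline{B_1'})$, $f^\pm\in C(\Omega^\pm)\cap L^\infty(B_1)$, $g\in L^\infty(\Gamma)$, and let $u\in C(\overline{B_1})$ satisfy, in the viscosity sense, $$\omega(x)\mathcal M^-(D^2u)\le f^\pm\ \text{ in }\Omega^\pm,\qquad u^+_\nu-u^-_\nu\le g\ \text{ on }\Gamma.$$ Then $$\sup_{B_1}u_-\le\sup_{\partial B_1}u_-+C\Big(\max_\Gamma g_++\|f^-_+\|_{L^d_\omega(\Omega^-)}+\|f^+_+\|_{L^d_\omega(\Omega^+)}\Big),$$ with $C$ depending only on $d,\lambda,\Lambda,\Psi$ and $a$.
   Context: Notation: $x=(x',x_d)\in\mathbb R^{d-1}\times\mathbb R$, $B_r$, $B_r'$ balls centered at $0$ in $\mathbb R^d$, $\mathbb R^{d-1}$. $0<\lambda\le\Lambda$; $\alpha_0\in(0,1)$ is the universal interior $C^{1,\alpha_0}$ exponent for $(\lambda,\Lambda)$-uniformly elliptic equations $F(D^2u)=0$. $\Omega^\pm=B_1\cap\{\pm(x_d-\Psi(x'))>0\}$, $\Gamma=B_1\cap\{x_d=\Psi(x')\}$, $\nu$ the unit normal to $\Gamma$ pointing into $\Omega^+$. $a:B_1\to[0,1)$ is continuous with $\max a<1$ and $\omega(x)=|x_d-\Psi(x')|^{a(x)}$; $\|f\|_{L^d_\omega(U)}:=\|f\omega^{-1}\|_{L^d(U)}$. $u_-=\max(-u,0)$, $h_+=\max(h,0)$. Pucci operators: $\mathcal M^+(M)=\Lambda\sum_{e_i>0}e_i+\lambda\sum_{e_i<0}e_i$,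 $\mathcal M^-(M)=\lambda\sum_{e_i>0}e_i+\Lambda\sum_{e_i<0}e_i$, $e_i$ eigenvalues of $M$. "$\omega\mathcal M^-(D^2u)\le f^\pm$ in $\Omega^\pm$ in the viscosity sense" means: for any $\varphi\in C^2$ touching $u$ from below at $x_0\in\Omega^\pm$, $\omega(x_0)\mathcal M^-(D^2\varphi(x_0))\le f^\pm(x_0)$. "$u^+_\nu-u^-_\nu\le g$ on $\Gamma$ in the viscosity sense" means: for any $x_0\in\Gamma$ and any $\varphi$ that is $C^1$ on $B_\delta(x_0)\cap\overline{\Omega^+}$ and on $B_\delta(x_0)\cap\overline{\Omega^-}$ touching $u$ from below at $x_0$, $\varphi^+_\nu(x_0)-\varphi^-_\nu(x_0)\le g(x_0)$, where $\varphi^\pm_\nu$ is the normal derivative of $\varphi|_{\overline{\Omega^\pm}}$. *)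

theory Defs
  imports "HOL-Analysis.Analysis"
begin

text \<open>Points of R^d are pairs (x', x_d) in 'm \<times> real, with 'm a Euclidean space of
  dimension d-1.\<close>

definition Omega_plus :: "('m::euclidean_space \<Rightarrow> real) \<Rightarrow> ('m \<times> real) set" where
  "Omega_plus Psi = ball 0 1 \<inter> {x. snd x - Psi (fst x) > 0}"

definition Omega_minus :: "('m::euclidean_space \<Rightarrow> real) \<Rightarrow> ('m \<times> real) set" where
  "Omega_minus Psi = ball 0 1 \<inter> {x. snd x - Psi (fst x) < 0}"

definition Gamma_if :: "('m::euclidean_space \<Rightarrow> real) \<Rightarrow> ('m \<times> real) set" where
  "Gamma_if Psi = ball 0 1 \<inter> {x. snd x = Psi (fst x)}"

definition weight :: "('m::euclidean_space \<Rightarrow> real) \<Rightarrow> ('m \<times> real \<Rightarrow> real) \<Rightarrow> 'm \<times> real \<Rightarrow> real" where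
  "weight Psi a x = \<bar>snd x - Psi (fst x)\<bar> powr (a x)"

definition C1alpha :: "real \<Rightarrow> 'm::euclidean_space set \<Rightarrow> ('m \<Rightarrow> real) \<Rightarrow> bool" where
  "C1alpha \<alpha> S Psi \<longleftrightarrow> (\<exists>G K. (\<forall>x\<in>S. (Psi has_derivative (\<lambda>h. G x \<bullet> h)) (at x within S)) \<and>
      (\<forall>x\<in>S. \<forall>y\<in>S. norm (G x - G y) \<le> K * norm (x - y) powr \<alpha>))"

definition grad :: "('a::euclidean_space \<Rightarrow> real) \<Rightarrow> 'a \<Rightarrow> 'a" where
  "grad f x = (THE G. (f has_derivative (\<lambda>h. G \<bullet> h)) (at x))"

text \<open>Unit normal to Gamma pointing into Omega_plus.\<close>
definition normal_nu :: "('m::euclidean_space \<Rightarrow> real) \<Rightarrow> 'm \<times> real \<Rightarrow> 'm \<times> real" where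
  "normal_nu Psi x = (1 / sqrt (1 + (norm (grad Psi (fst x)))\<^sup>2)) *\<^sub>R (- grad Psi (fst x), 1)"

definition orthonormal_eigenbasis :: "('a::euclidean_space \<Rightarrow> 'a) \<Rightarrow> 'a set \<Rightarrow> bool" where
  "orthonormal_eigenbasis M B \<longleftrightarrow> finite B \<and> card B = DIM('a) \<and> pairwise orthogonal B \<and>
     (\<forall>v\<in>B. norm v = 1 \<and> (\<exists>e. M v = e *\<^sub>R v))"

definition pucci_minus :: "real \<Rightarrow> real \<Rightarrow> ('a::euclidean_space \<Rightarrow> 'a) \<Rightarrow> real" where
  "pucci_minus lam Lam M = (THE s. \<exists>B. orthonormal_eigenbasis M B \<and>
      s = (\<Sum>v\<in>B. (if v \<bullet> M v > 0 then lam * (v \<bullet> M v) else Lam * (v \<bullet> M v))))"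

definition C2_on :: "'a::euclidean_space set \<Rightarrow> ('a \<Rightarrow> real) \<Rightarrow> ('a \<Rightarrow> 'a) \<Rightarrow> ('a \<Rightarrow> 'a \<Rightarrow> 'a) \<Rightarrow> bool" where
  "C2_on U phi G H \<longleftrightarrow> (\<forall>y\<in>U. (phi has_derivative (\<lambda>h. G y \<bullet> h)) (at y) \<and> (G has_derivative H y) (at y))
      \<and> (\<forall>v. continuous_on U (\<lambda>y. H y v))"

definition visc_super :: "real \<Rightarrow> real \<Rightarrow> ('m::euclidean_space \<Rightarrow> real) \<Rightarrow> ('m \<times> real \<Rightarrow> real)
    \<Rightarrow> ('m \<times> real) set \<Rightarrow> ('m \<times> real \<Rightarrow> real) \<Rightarrow> ('m \<times> real \<Rightarrow> real) \<Rightarrow> bool" where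
  "visc_super lam Lam Psi a Omega f u \<longleftrightarrow>
     (\<forall>x0\<in>Omega. \<forall>phi r G H. 0 < r \<and> ball x0 r \<subseteq> Omega \<and> C2_on (ball x0 r) phi G H \<and>
        phi x0 = u x0 \<and> (\<forall>y\<in>ball x0 r. phi y \<le> u y)
        \<longrightarrow> weight Psi a x0 * pucci_minus lam Lam (H x0) \<le> f x0)"

definition visc_transmission :: "('m::euclidean_space \<Rightarrow> real) \<Rightarrow> ('m \<times> real \<Rightarrow> real)
    \<Rightarrow> ('m \<times> real \<Rightarrow> real) \<Rightarrow> bool" where
  "visc_transmission Psi g u \<longleftrightarrow>
     (\<forall>x0\<in>Gamma_if Psi. \<forall>phi \<delta> Gp Gm.
        (let Sp = ball x0 \<delta> \<inter> closure (Omega_plus Psi); Sm = ball x0 \<delta> \<inter> closure (Omega_minus Psi) in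
          0 < \<delta> \<and>
          (\<forall>y\<in>Sp. (phi has_derivative (\<lambda>h. Gp y \<bullet> h)) (at y within Sp)) \<and> continuous_on Sp Gp \<and>
          (\<forall>y\<in>Sm. (phi has_derivative (\<lambda>h. Gm y \<bullet> h)) (at y within Sm)) \<and> continuous_on Sm Gm \<and>
          phi x0 = u x0 \<and> (\<forall>y\<in>ball x0 \<delta> \<inter> ball 0 1. phi y \<le> u y))
        \<longrightarrow> Gp x0 \<bullet> normal_nu Psi x0 - Gm x0 \<bullet> normal_nu Psi x0 \<le> g x0)"

definition Ld_omega_norm :: "('m::euclidean_space \<Rightarrow> real) \<Rightarrow> ('m \<times> real \<Rightarrow> real)
    \<Rightarrow> ('m \<times> real) set \<Rightarrow> ('m \<times> real \<Rightarrow> real) \<Rightarrow> ennreal" where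
  "Ld_omega_norm Psi a U h =
     (let I = (\<integral>\<^sup>+ x. indicator U x * ennreal (\<bar>h x / weight Psi a x\<bar> ^ DIM('m \<times> real)) \<partial>lborel)
      in if I = \<infinity> then \<infinity> else ennreal (enn2real I powr (1 / real DIM('m \<times> real))))"

end

theory Submission
  imports Defs
begin

text \<open>An Aleksandrov--Bakelman--Pucci argument without convex envelopes. Add to \<open>u\<close> a multiple
  \<open>k > max g\<^sub>+\<close> of the barrier \<open>w x = inf z. barrier z x\<close>, which vanishes on the interface,
  lies below \<open>- \<bar>x\<^sub>d - \<Psi> x'\<bar>\<close>, and is a supersolution up to a bounded error on both sides, since
  it is touched from above by explicit smooth functions. Its kink prevents affine functions from
  touching \<open>u + k w\<close> from below on the interface, so every slope of size at most half the excess of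
  \<open>sup u\<^sub>-\<close> over the boundary supremum is attained at a contact point in \<open>\<Omega>\<^sup>+\<close> or \<open>\<Omega>\<^sup>-\<close>. There a paraboloid
  test shows that the slopes at contact points at distance \<open>r\<close> differ by at most a multiple of
  \<open>(f\<^sub>+ / \<omega> + k) r\<close>, and covering by small cubes bounds the volume of the set of slopes by
  \<open>\<integral> (f\<^sub>+ / \<omega> + k) ^ d\<close>. The infimum over \<open>z\<close> is never formed: contact is stated jointly in \<open>x\<close>
  and \<open>z\<close>, so that attainment and the touching function come for free.\<close>

text \<open>The obstacle is the low regularity of the interface. \<open>Psi\<close> is only
  C^{1,alpha}, so the height \<open>x_d - Psi x'\<close> cannot enter a C^2 test function. Freezing
  the tangent plane at a base point \<open>z\<close> makes the height \<open>L\<close> affine, at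
  the price of a Taylor error \<open>K * r powr (1 + \<alpha>)\<close> with
  \<open>r = norm (x' - z)\<close>. A convex term of the same homogeneity pays for that error, but
  its Hessian may be as large as \<open>\<bar>L\<bar> powr (\<alpha> - 1)\<close>, unbounded near
  the plane; hence the concave power of \<open>\<bar>L\<bar>\<close>, whose Hessian has the same
  size and the opposite sign. Every frozen plane also carries a kink that may run through the
  interior of either side. Minimising over \<open>z\<close> avoids it: off the interface the choice
  \<open>z = x'\<close> makes the barrier negative, while on its own kink plane a barrier is
  nonnegative. What remains of the Hessian is bounded and scales with \<open>k\<close>, so it acts
  as an extra bounded right-hand side. This is how the jump datum reaches the final estimate
  linearly, once \<open>k\<close> decreases to \<open>max g\<^sub>+\<close>.\<close>

section \<open>Lower bounds for the Pucci operator\<close>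

text \<open>This is \<open>orthonormal_eigenbasis\<close> stripped of the operator. Hessian bounds
  are proved for every such basis, because the eigenbasis of a test function is never
  computed.\<close>

definition orthonormal_basis :: "'a::euclidean_space set \<Rightarrow> bool" where
  "orthonormal_basis B \<longleftrightarrow> finite B \<and> card B = DIM('a) \<and> pairwise orthogonal B \<and> (\<forall>v\<in>B. norm v = 1)"

lemma orthonormal_set_independent:
  fixes B :: "'a::euclidean_space set"
  assumes "pairwise orthogonal B" "\<forall>v\<in>B. norm v = 1"
  shows "independent B"
  using assms pairwise_orthogonal_independent[of B] by (metis norm_zero zero_neq_one)

lemma orthonormal_basis_span:
  fixes B :: "'a::euclidean_space set"
  assumes "orthonormal_basis B"
  shows "span B = UNIV"
proof -
  have "independent B" "card B = DIM('a)"
    using assms orthonormal_set_independent unfolding orthonormal_basis_def by auto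
  then have "dim (span B) = DIM('a)"
    by (simp add: dim_eq_card_independent)
  then show ?thesis
    by (simp add: dim_eq_full)
qed

lemma orthonormal_basis_parseval:
  assumes "orthonormal_basis B"
  shows "(\<Sum>v\<in>B. (x \<bullet> v)\<^sup>2) = (norm x)\<^sup>2"
proof -
  have x: "(\<Sum>v\<in>B. (x \<bullet> v) *\<^sub>R v) = x"
    using assms orthonormal_basis_span[OF assms]
    by (intro orthonormal_basis_expand) (auto simp: orthonormal_basis_def)
  have "(norm x)\<^sup>2 = x \<bullet> (\<Sum>v\<in>B. (x \<bullet> v) *\<^sub>R v)"
    unfolding x by (simp add: power2_norm_eq_inner)
  then show ?thesis
    by (simp add: inner_sum_right power2_eq_square)
qed

text \<open>The unit vector \<open>e\<close> maximises the quadratic form on \<open>T\<close>. The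
  residual \<open>y = M e - \<mu> *\<^sub>R e\<close> stays in \<open>T\<close> and is orthogonal to
  \<open>e\<close>. Moving \<open>e\<close> along \<open>y\<close> gains
  \<open>2 * s * (y \<bullet> y)\<close> to first order, so maximality forces
  \<open>y = 0\<close>.\<close>

lemma symmetric_operator_eigenvector:
  fixes M :: "'a::euclidean_space \<Rightarrow> 'a"
  assumes M: "linear M" and sym: "\<And>x y. x \<bullet> M y = M x \<bullet> y"
    and T: "subspace T" "T \<noteq> {0}" and inv: "\<And>x. x \<in> T \<Longrightarrow> M x \<in> T"
  obtains e \<mu> where "e \<in> T" "norm e = 1" "M e = \<mu> *\<^sub>R e"
proof -
  obtain t where t: "t \<in> T" "t \<noteq> 0"
    using T subspace_0[of T] by blast
  have ne: "sphere 0 1 \<inter> T \<noteq> {}"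
  proof -
    have "(1 / norm t) *\<^sub>R t \<in> sphere 0 1 \<inter> T"
      using t T by (simp add: subspace_scale)
    then show ?thesis by blast
  qed
  have "compact (sphere 0 1 \<inter> T)"
    by (intro compact_Int_closed compact_sphere closed_subspace T)
  moreover have "continuous_on (sphere 0 1 \<inter> T) (\<lambda>x. x \<bullet> M x)"
    using M by (intro continuous_intros linear_continuous_on) (simp add: linear_linear)
  ultimately obtain e where e: "e \<in> sphere 0 1 \<inter> T"
      and max: "\<And>x. x \<in> sphere 0 1 \<inter> T \<Longrightarrow> x \<bullet> M x \<le> e \<bullet> M e"
    using continuous_attains_sup[OF _ ne] by blast
  define \<mu> where "\<mu> = e \<bullet> M e"
  have ee: "e \<bullet> e = 1" using e by (simp add: norm_eq_1)
  have Q: "x \<bullet> M x \<le> \<mu> * (x \<bullet> x)" if x: "x \<in> T" for x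
  proof (cases "x = 0")
    case True
    then show ?thesis by simp
  next
    case False
    let ?y = "(1 / norm x) *\<^sub>R x"
    have "?y \<in> sphere 0 1 \<inter> T"
      using False x T by (simp add: subspace_scale)
    then have "?y \<bullet> M ?y \<le> \<mu>"
      using max unfolding \<mu>_def by blast
    then have "(x \<bullet> M x) / (norm x)\<^sup>2 \<le> \<mu>"
      by (simp add: linear_cmul[OF M] power2_eq_square)
    then show ?thesis
      using False by (simp add: divide_le_eq power2_norm_eq_inner split: if_splits)
  qed
  define y where "y = M e - \<mu> *\<^sub>R e"
  have yT: "y \<in> T"
    unfolding y_def using e inv T by (simp add: subspace_diff subspace_scale)
  have ey: "e \<bullet> y = 0"
    unfolding y_def \<mu>_def using ee by (simp add: inner_diff_right)
  have My: "y \<bullet> M e = y \<bullet> y"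
    using ey unfolding y_def by (simp add: inner_diff_right inner_diff_left inner_commute)
  define q where "q = y \<bullet> M y - \<mu> * (y \<bullet> y)"
  have lin: "2 * (s * (y \<bullet> y)) + s\<^sup>2 * q \<le> 0" for s
  proof -
    have "(e + s *\<^sub>R y) \<bullet> M (e + s *\<^sub>R y) \<le> \<mu> * ((e + s *\<^sub>R y) \<bullet> (e + s *\<^sub>R y))"
      using e yT T by (intro Q) (simp add: subspace_add subspace_scale)
    moreover have "e \<bullet> M y = y \<bullet> y" "e \<bullet> M e = \<mu>"
      using sym My by (simp_all add: inner_commute \<mu>_def)
    ultimately show ?thesis
      using ee ey My
      by (simp add: linear_add[OF M] linear_cmul[OF M] inner_add_left inner_add_right
          inner_commute q_def power2_eq_square algebra_simps)
  qed
  have "y \<bullet> y = 0"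
  proof (rule ccontr)
    assume "y \<bullet> y \<noteq> 0"
    then have pos: "y \<bullet> y > 0" by (simp add: less_le)
    \<comment> \<open>Small enough that the quadratic term \<open>s * q\<close> cannot cancel the
      linear gain.\<close>
    define s where "s = (y \<bullet> y) / (\<bar>q\<bar> + 1)"
    have s: "s > 0" using pos by (simp add: s_def)
    have "s * \<bar>q\<bar> \<le> y \<bullet> y"
      using pos by (simp add: s_def field_simps)
    then have "s * (- q) \<le> y \<bullet> y"
      using s by (smt (verit) mult_left_mono)
    moreover have "s * (2 * (y \<bullet> y) + s * q) \<le> 0"
      using lin[of s] by (simp add: power2_eq_square algebra_simps)
    then have "2 * (y \<bullet> y) + s * q \<le> 0"
      using s by (simp add: mult_le_0_iff)
    ultimately show False using pos by simp
  qed
  then have "M e = \<mu> *\<^sub>R e" by (simp add: y_def)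
  with e show ?thesis by (intro that) auto
qed

text \<open>\<open>pucci_minus\<close> is a definite description and says nothing without an
  eigenbasis. A largest orthonormal family of eigenvectors is a basis: by symmetry its orthogonal
  complement is invariant, and a nonzero complement would supply one more eigenvector.\<close>

lemma symmetric_operator_eigenbasis:
  fixes M :: "'a::euclidean_space \<Rightarrow> 'a"
  assumes M: "linear M" and sym: "\<And>x y. x \<bullet> M y = M x \<bullet> y"
  shows "\<exists>B. orthonormal_eigenbasis M B"
proof -
  let ?P = "\<lambda>B. pairwise orthogonal B \<and> (\<forall>v\<in>B. norm v = 1 \<and> (\<exists>e. M v = e *\<^sub>R v))"
  let ?N = "\<lambda>n. \<exists>B. ?P B \<and> card B = n"
  have fin: "finite B \<and> card B \<le> DIM('a)" if "?P B" for B
    using orthonormal_set_independent[of B] that independent_bound by blast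
  have "?N 0" by (rule exI[of _ "{}"]) (simp add: pairwise_def)
  then obtain n where n: "?N n" and mx: "\<And>m. ?N m \<Longrightarrow> m \<le> n"
    using fin GreatestI_nat[of ?N 0 "DIM('a)"] Greatest_le_nat[of ?N _ "DIM('a)"] by blast
  then obtain B where B: "?P B" "card B = n" by blast
  have "\<not> card B < DIM('a)"
  proof
    assume less: "card B < DIM('a)"
    let ?T = "{y. \<forall>x\<in>B. orthogonal x y}"
    have "dim B < DIM('a)"
      using less dim_le_card[OF order_refl, of B] fin[OF B(1)] by (meson order.strict_trans1 dim_le_card' )
    then obtain x where x: "x \<noteq> 0" "\<And>y. y \<in> span B \<Longrightarrow> orthogonal x y"
      using orthogonal_to_subspace_exists[of B] by blast
    have xT: "x \<in> ?T"
      using x(2) by (auto simp: orthogonal_commute span_base)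
    have inv: "M y \<in> ?T" if y: "y \<in> ?T" for y
    proof -
      have "v \<bullet> M y = 0" if v: "v \<in> B" for v
      proof -
        obtain c where "M v = c *\<^sub>R v" using B v by blast
        then show ?thesis using sym y v by (simp add: orthogonal_def)
      qed
      then show ?thesis by (simp add: orthogonal_def)
    qed
    have "?T \<noteq> {0}" using x xT by blast
    then obtain e \<mu> where e: "e \<in> ?T" "norm e = 1" "M e = \<mu> *\<^sub>R e"
      using symmetric_operator_eigenvector[OF M sym subspace_orthogonal_to_vectors _ inv] by blast
    have "?P (insert e B)"
      using e B by (auto simp: pairwise_insert orthogonal_commute)
    moreover have "e \<notin> B"
      using e by (auto simp: orthogonal_def)
    then have "card (insert e B) = Suc n"
      using B fin[OF B(1)] by simp
    ultimately have "Suc n \<le> n" using mx by blast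
    then show False by simp
  qed
  then have "orthonormal_eigenbasis M B"
    using B fin[OF B(1)] by (auto simp: orthonormal_eigenbasis_def)
  then show ?thesis by blast
qed

text \<open>The uniqueness half of the well-definedness of \<open>pucci_minus\<close>. Parseval
  turns either sum into a double sum with weights \<open>(v \<bullet> w)\<^sup>2\<close>, and a
  nonzero weight forces the two eigenvalues to agree, so multiplicities never have to be
  matched.\<close>

lemma eigenbasis_sum_unique:
  fixes M :: "'a::euclidean_space \<Rightarrow> 'a" and g :: "real \<Rightarrow> real"
  assumes sym: "\<And>x y. x \<bullet> M y = M x \<bullet> y"
    and B: "orthonormal_eigenbasis M B" and C: "orthonormal_eigenbasis M C"
  shows "(\<Sum>v\<in>B. g (v \<bullet> M v)) = (\<Sum>w\<in>C. g (w \<bullet> M w))"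
proof -
  have on: "orthonormal_basis B" "orthonormal_basis C"
    using B C by (auto simp: orthonormal_eigenbasis_def orthonormal_basis_def)
  have eig: "M v = (v \<bullet> M v) *\<^sub>R v" if "v \<in> B \<union> C" for v
  proof -
    obtain e where "M v = e *\<^sub>R v" "norm v = 1"
      using \<open>v \<in> B \<union> C\<close> B C by (auto simp: orthonormal_eigenbasis_def)
    then show ?thesis by (simp add: norm_eq_1)
  qed
  have sw: "g (v \<bullet> M v) * (v \<bullet> w)\<^sup>2 = g (w \<bullet> M w) * (w \<bullet> v)\<^sup>2" if vw: "v \<in> B" "w \<in> C" for v w
  proof (cases "v \<bullet> w = 0")
    case True
    then show ?thesis by (simp add: inner_commute)
  next
    case False
    have "v \<bullet> M w = (w \<bullet> M w) * (v \<bullet> w)"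
      by (subst eig[of w]) (use vw in auto)
    moreover have "M v \<bullet> w = (v \<bullet> M v) * (v \<bullet> w)"
      by (subst eig[of v]) (use vw in auto)
    ultimately have "w \<bullet> M w = v \<bullet> M v"
      using sym[of v w] False by simp
    then show ?thesis by (simp add: inner_commute)
  qed
  have "(\<Sum>v\<in>B. g (v \<bullet> M v)) = (\<Sum>v\<in>B. g (v \<bullet> M v) * (\<Sum>w\<in>C. (v \<bullet> w)\<^sup>2))"
    using on by (intro sum.cong) (auto simp: orthonormal_basis_parseval orthonormal_basis_def)
  also have "\<dots> = (\<Sum>v\<in>B. \<Sum>w\<in>C. g (w \<bullet> M w) * (w \<bullet> v)\<^sup>2)"
    unfolding sum_distrib_left by (intro sum.cong refl sw)
  also have "\<dots> = (\<Sum>w\<in>C. g (w \<bullet> M w) * (\<Sum>v\<in>B. (w \<bullet> v)\<^sup>2))"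
    by (subst sum.swap) (simp add: sum_distrib_left)
  also have "\<dots> = (\<Sum>w\<in>C. g (w \<bullet> M w))"
    using on by (intro sum.cong) (auto simp: orthonormal_basis_parseval orthonormal_basis_def)
  finally show ?thesis .
qed

text \<open>For \<open>p, q \<ge> 0\<close> the function \<open>g\<close> of the proof satisfies
  \<open>lam * p - Lam * q \<le> g (p - q)\<close>. Any splitting of the Hessian into nonnegative
  forms therefore gives a bound without diagonalising; it is required on all orthonormal bases since
  one of them is the unknown eigenbasis.\<close>

lemma pucci_minus_ge:
  fixes M :: "'a::euclidean_space \<Rightarrow> 'a"
  assumes lam: "0 < lam" "lam \<le> Lam"
    and M: "linear M" and sym: "\<And>x y. x \<bullet> M y = M x \<bullet> y"
    and split: "\<And>v. v \<bullet> M v = P v - Q v" and P: "\<And>v. 0 \<le> P v" and Q: "\<And>v. 0 \<le> Q v"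
    and le: "\<And>B. orthonormal_basis B \<Longrightarrow> X \<le> lam * (\<Sum>v\<in>B. P v) - Lam * (\<Sum>v\<in>B. Q v)"
  shows "X \<le> pucci_minus lam Lam M"
proof -
  define g where "g t = (if t > 0 then lam * t else Lam * t)" for t :: real
  obtain B where B: "orthonormal_eigenbasis M B"
    using symmetric_operator_eigenbasis[OF M sym] by blast
  have "pucci_minus lam Lam M = (\<Sum>v\<in>B. g (v \<bullet> M v))"
    unfolding pucci_minus_def g_def[symmetric]
    using B eigenbasis_sum_unique[OF sym] by (intro the_equality) blast+
  moreover have "lam * P v - Lam * Q v \<le> g (v \<bullet> M v)" for v
    using lam P[of v] Q[of v] mult_right_mono[OF lam(2) P[of v]] mult_right_mono[OF lam(2) Q[of v]]
    by (auto simp: g_def split algebra_simps)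
  then have "lam * (\<Sum>v\<in>B. P v) - Lam * (\<Sum>v\<in>B. Q v) \<le> (\<Sum>v\<in>B. g (v \<bullet> M v))"
    by (simp add: sum_distrib_left flip: sum_subtractf) (rule sum_mono, simp)
  moreover have "orthonormal_basis B"
    using B by (auto simp: orthonormal_eigenbasis_def orthonormal_basis_def)
  ultimately show ?thesis using le[of B] by linarith
qed

section \<open>Volume of a set of slopes\<close>

text \<open>The covering pieces \<open>B K\<close> may overlap; what matters is that each is charged
  to the integral over its own \<open>A K\<close>, and these are disjoint. Only the pieces have to
  be measurable, not \<open>T\<close>.\<close>

lemma emeasure_countable_charge:
  fixes T :: "'a::euclidean_space set" and F :: "'a \<Rightarrow> ennreal"
  assumes D: "countable D" and disj: "disjoint_family_on A D"
    and A: "\<And>K. K \<in> D \<Longrightarrow> A K \<in> sets lborel" and S: "\<And>K. K \<in> D \<Longrightarrow> A K \<subseteq> U"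
    and B: "\<And>K. K \<in> D \<Longrightarrow> B K \<in> sets lborel" and T: "T \<subseteq> (\<Union>K\<in>D. B K)"
    and F: "(\<lambda>x. indicator U x * F x) \<in> borel_measurable lborel"
    and le: "\<And>K. K \<in> D \<Longrightarrow> emeasure lborel (B K) \<le> (\<integral>\<^sup>+x. indicator (A K) x * F x \<partial>lborel)"
  shows "emeasure lborel T \<le> (\<integral>\<^sup>+x. indicator U x * F x \<partial>lborel)"
proof -
  let ?f = "\<lambda>n. from_nat_into D n" and ?I = "to_nat_on D ` D"
  define A' where "A' n = (if n \<in> ?I then A (?f n) else {})" for n
  define B' where "B' n = (if n \<in> ?I then B (?f n) else {})" for n
  have f: "?f n \<in> D" "to_nat_on D (?f n) = n" if "n \<in> ?I" for n
    using that D by auto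
  have f2: "to_nat_on D K \<in> ?I" "?f (to_nat_on D K) = K" if "K \<in> D" for K
    using that D by auto
  have sets: "A' n \<in> sets lborel" "B' n \<in> sets lborel" for n
    using A B f unfolding A'_def B'_def by auto
  have "disjoint_family A'"
    unfolding disjoint_family_on_def
  proof (intro ballI impI)
    fix m n :: nat assume mn: "m \<noteq> n"
    show "A' m \<inter> A' n = {}"
    proof (cases "m \<in> ?I \<and> n \<in> ?I")
      case True
      then have "?f m \<noteq> ?f n" using mn f(2) by metis
      then show ?thesis
        using disj f(1) True by (simp add: A'_def disjoint_family_on_def)
    qed (auto simp: A'_def)
  qed
  then have ind: "(\<Sum>n. indicator (A' n) x :: ennreal) \<le> indicator U x" for x
  proof -
    have "(\<Sum>n. indicator (A' n) x :: ennreal) = indicator (\<Union>n. A' n) x"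
      using \<open>disjoint_family A'\<close> by (rule suminf_indicator)
    moreover have "(\<Union>n. A' n) \<subseteq> U"
      using S f unfolding A'_def by (fastforce split: if_splits)
    ultimately show ?thesis by (auto simp: indicator_def)
  qed
  have "T \<subseteq> (\<Union>n. B' n)"
  proof
    fix t assume "t \<in> T"
    then obtain K where "K \<in> D" "t \<in> B K" using T by blast
    then have "t \<in> B' (to_nat_on D K)" using f2 by (simp add: B'_def)
    then show "t \<in> (\<Union>n. B' n)" by blast
  qed
  then have "emeasure lborel T \<le> emeasure lborel (\<Union>n. B' n)"
    using sets by (intro emeasure_mono) auto
  also have "\<dots> \<le> (\<Sum>n. emeasure lborel (B' n))"
    using sets by (intro emeasure_subadditive_countably) auto
  also have "\<dots> \<le> (\<Sum>n. \<integral>\<^sup>+x. indicator (A' n) x * (indicator U x * F x) \<partial>lborel)"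
  proof (intro suminf_le)
    fix n
    show "emeasure lborel (B' n) \<le> (\<integral>\<^sup>+x. indicator (A' n) x * (indicator U x * F x) \<partial>lborel)"
    proof (cases "n \<in> ?I")
      case True
      have "indicator (A (?f n)) x * (indicator U x * F x) = indicator (A (?f n)) x * F x" for x
        using S[OF f(1)[OF True]] by (auto simp: indicator_def)
      then show ?thesis
        using le[OF f(1)[OF True]] True by (simp add: A'_def B'_def)
    qed (simp add: A'_def B'_def)
  qed auto
  also have "\<dots> = (\<integral>\<^sup>+x. (\<Sum>n. indicator (A' n) x * (indicator U x * F x)) \<partial>lborel)"
  proof (intro nn_integral_suminf[symmetric])
    fix n
    have "A' n \<in> sets borel" using sets by simp
    then show "(\<lambda>x. indicator (A' n) x * (indicator U x * F x)) \<in> borel_measurable lborel"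
      using F by measurable
  qed
  also have "\<dots> \<le> (\<integral>\<^sup>+x. indicator U x * F x \<partial>lborel)"
  proof (intro nn_integral_mono)
    fix x
    have "(\<Sum>n. indicator (A' n) x * (indicator U x * F x))
        = (\<Sum>n. indicator (A' n) x) * (indicator U x * F x)"
      by (rule ennreal_suminf_multc)
    also have "\<dots> \<le> indicator U x * (indicator U x * F x)"
      using ind by (intro mult_right_mono) auto
    also have "\<dots> = indicator U x * F x" by (simp add: indicator_def)
    finally show "(\<Sum>n. indicator (A' n) x * (indicator U x * F x)) \<le> indicator U x * F x" .
  qed
  finally show ?thesis .
qed

text \<open>A covering argument takes the place of the area formula for the subdifferential: no
  differentiability of the slope map is needed, because on a small cube around \<open>x\<close> all slopes lie
  in one ball of radius comparable to \<open>F x\<close> times the side length.\<close>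
lemma emeasure_slopes_le:
  fixes U T :: "'a::euclidean_space set" and F :: "'a \<Rightarrow> real"
  assumes U: "open U" "U \<subseteq> cbox (- One) One"
    and F: "continuous_on U F" "\<And>x. x \<in> U \<Longrightarrow> 0 < F x" and c: "0 \<le> c"
    and loc: "\<And>x. x \<in> U \<Longrightarrow> \<exists>\<delta>>0. \<forall>x0\<in>ball x \<delta>. \<forall>x1\<in>ball x \<delta>. \<forall>p0 p1 r.
        contact x0 p0 \<longrightarrow> contact x1 p1 \<longrightarrow> dist x0 x1 \<le> r \<longrightarrow> 0 < r \<longrightarrow> r < \<delta>
        \<longrightarrow> norm (p1 - p0) \<le> c * F x * r"
    and T: "\<And>p. p \<in> T \<Longrightarrow> \<exists>x\<in>U. contact x p"
  shows "emeasure lborel T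
    \<le> (\<integral>\<^sup>+x. indicator U x * ennreal (unit_ball_vol (real DIM('a)) * (2 * c * DIM('a)) ^ DIM('a) * F x ^ DIM('a)) \<partial>lborel)"
proof -
  let ?d = "DIM('a)"
  have "\<exists>\<delta>>0. ball x \<delta> \<subseteq> U \<and> (\<forall>y\<in>ball x \<delta>. F x \<le> 2 * F y) \<and>
      (\<forall>x0\<in>ball x \<delta>. \<forall>x1\<in>ball x \<delta>. \<forall>p0 p1 r.
        contact x0 p0 \<longrightarrow> contact x1 p1 \<longrightarrow> dist x0 x1 \<le> r \<longrightarrow> 0 < r \<longrightarrow> r < 2 * real ?d * \<delta>
        \<longrightarrow> norm (p1 - p0) \<le> c * F x * r)" if x: "x \<in> U" for x
  proof -
    obtain d1 where d1: "d1 > 0" "ball x d1 \<subseteq> U"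
      using U x open_contains_ball by blast
    have "isCont F x" using F U x by (simp add: continuous_on_eq_continuous_at)
    then obtain d2 where d2: "d2 > 0" "\<And>y. dist y x < d2 \<Longrightarrow> dist (F y) (F x) < F x / 2"
      using F(2)[OF x] unfolding continuous_at_eps_delta by (metis half_gt_zero)
    obtain d3 where d3: "d3 > 0" "\<forall>x0\<in>ball x d3. \<forall>x1\<in>ball x d3. \<forall>p0 p1 r.
        contact x0 p0 \<longrightarrow> contact x1 p1 \<longrightarrow> dist x0 x1 \<le> r \<longrightarrow> 0 < r \<longrightarrow> r < d3
        \<longrightarrow> norm (p1 - p0) \<le> c * F x * r"
      using loc[OF x] by blast
    \<comment> \<open>The factor \<open>2 * d\<close> leaves room for \<open>r = d * l\<close>, the
      bound on the diameter of a cube of side \<open>l\<close> through the l1 norm; a cube inside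
      \<open>ball x \<delta>\<close> has \<open>l < 2 * \<delta>\<close>.\<close>
    define \<delta> where "\<delta> = min (min d1 d2) (d3 / (2 * ?d))"
    have dd: "1 \<le> real ?d" by (simp add: Suc_leI)
    have \<delta>: "0 < \<delta>" "\<delta> \<le> d1" "\<delta> \<le> d2"
      using d1 d2 d3 dd by (auto simp: \<delta>_def)
    have "\<delta> \<le> d3 / (2 * ?d)" by (simp add: \<delta>_def)
    then have "2 * real ?d * \<delta> \<le> d3" using dd by (simp add: field_simps)
    note \<delta> = \<delta> this
    have "\<delta> \<le> 2 * real ?d * \<delta>"
    proof -
      have "1 \<le> 2 * real ?d" using dd by linarith
      then show ?thesis using mult_right_mono[of 1 "2 * real ?d" \<delta>] \<delta>(1) by linarith
    qed
    then have "\<delta> \<le> d3" using \<delta> by linarith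
    show ?thesis
    proof (intro exI[of _ \<delta>] conjI ballI)
      fix y assume "y \<in> ball x \<delta>"
      then have "dist y x < d2" using \<delta> by (simp add: dist_commute)
      then have "dist (F y) (F x) < F x / 2" by (rule d2)
      then show "F x \<le> 2 * F y" unfolding dist_real_def by linarith
    next
      fix x0 x1 assume "x0 \<in> ball x \<delta>" "x1 \<in> ball x \<delta>"
      then have "x0 \<in> ball x d3" "x1 \<in> ball x d3" using \<open>\<delta> \<le> d3\<close> by auto
      then show "\<forall>p0 p1 r. contact x0 p0 \<longrightarrow> contact x1 p1 \<longrightarrow> dist x0 x1 \<le> r \<longrightarrow> 0 < r \<longrightarrow>
          r < 2 * real ?d * \<delta> \<longrightarrow> norm (p1 - p0) \<le> c * F x * r"
        using d3 \<delta>(4) by (meson order.strict_trans2)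
    qed (use d1 \<delta> in auto)
  qed
  then have "\<forall>x\<in>U. \<exists>\<delta>. \<delta> > 0 \<and> ball x \<delta> \<subseteq> U \<and> (\<forall>y\<in>ball x \<delta>. F x \<le> 2 * F y) \<and>
      (\<forall>x0\<in>ball x \<delta>. \<forall>x1\<in>ball x \<delta>. \<forall>p0 p1 r.
        contact x0 p0 \<longrightarrow> contact x1 p1 \<longrightarrow> dist x0 x1 \<le> r \<longrightarrow> 0 < r \<longrightarrow> r < 2 * real ?d * \<delta>
        \<longrightarrow> norm (p1 - p0) \<le> c * F x * r)" by blast
  from bchoice[OF this] obtain \<delta> where \<delta>': "\<forall>x\<in>U. \<delta> x > 0 \<and> ball x (\<delta> x) \<subseteq> U \<and> (\<forall>y\<in>ball x (\<delta> x). F x \<le> 2 * F y) \<and>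
      (\<forall>x0\<in>ball x (\<delta> x). \<forall>x1\<in>ball x (\<delta> x). \<forall>p0 p1 r.
        contact x0 p0 \<longrightarrow> contact x1 p1 \<longrightarrow> dist x0 x1 \<le> r \<longrightarrow> 0 < r \<longrightarrow> r < 2 * real ?d * \<delta> x
        \<longrightarrow> norm (p1 - p0) \<le> c * F x * r)" ..
  then have \<delta>: "\<And>x. x \<in> U \<Longrightarrow> \<delta> x > 0" "\<And>x. x \<in> U \<Longrightarrow> ball x (\<delta> x) \<subseteq> U"
    "\<And>x y. x \<in> U \<Longrightarrow> y \<in> ball x (\<delta> x) \<Longrightarrow> F x \<le> 2 * F y"
    by blast+
  have \<delta>4: "norm (p1 - p0) \<le> c * F x * r" if "x \<in> U" "x0 \<in> ball x (\<delta> x)" "x1 \<in> ball x (\<delta> x)"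
    "contact x0 p0" "contact x1 p1" "dist x0 x1 \<le> r" "0 < r" "r < 2 * real ?d * \<delta> x" for x x0 x1 p0 p1 r
    using \<delta>' that by blast
  \<comment> \<open>The value outside \<open>U\<close> is a dummy: a gauge is total, but the
    covering lemma places its tags in \<open>U\<close>.\<close>
  define \<gamma> where "\<gamma> x = (if x \<in> U then ball x (\<delta> x) else UNIV)" for x
  have "gauge \<gamma>" using \<delta>(1) by (auto simp: gauge_def \<gamma>_def)
  have "box (- One) (One::'a) \<noteq> {}" by (simp add: box_ne_empty)
  have "\<exists>\<D>. countable \<D> \<and> (\<forall>K\<in>\<D>. \<exists>c d. K = cbox c d)
      \<and> pairwise (\<lambda>A B. interior A \<inter> interior B = {}) \<D> \<and> (\<forall>K\<in>\<D>. \<exists>x\<in>U \<inter> K. K \<subseteq> \<gamma> x)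
      \<and> (\<forall>u v. cbox u v \<in> \<D> \<longrightarrow> (\<exists>n. \<forall>i\<in>Basis. v \<bullet> i - u \<bullet> i = 2 / 2 ^ n)) \<and> U \<subseteq> \<Union>\<D>"
  proof (rule covering_lemma[OF U(2) \<open>box (- One) One \<noteq> {}\<close> \<open>gauge \<gamma>\<close>], goal_cases)
    case (1 \<D>)
    show ?case
    proof (intro exI[of _ \<D>] conjI)
      show "\<forall>K\<in>\<D>. \<exists>c d. K = cbox c d" using 1(3) by blast
      show "\<forall>K\<in>\<D>. \<exists>x\<in>U \<inter> K. K \<subseteq> \<gamma> x" using 1(5) by blast
      show "\<forall>u v. cbox u v \<in> \<D> \<longrightarrow> (\<exists>n. \<forall>i\<in>Basis. v \<bullet> i - u \<bullet> i = 2 / 2 ^ n)"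
      proof (intro allI impI)
        fix u v :: 'a assume "cbox u v \<in> \<D>"
        from 1(6)[OF this] obtain n where n: "\<forall>i\<in>Basis. v \<bullet> i - u \<bullet> i = (One \<bullet> i - (- One) \<bullet> i) / 2 ^ n" ..
        then show "\<exists>n. \<forall>i\<in>Basis. v \<bullet> i - u \<bullet> i = 2 / 2 ^ n" by (intro exI[of _ n]) simp
      qed
    qed (fact 1)+
  qed
  then obtain \<D> where \<D>: "countable \<D>"
    "\<forall>K\<in>\<D>. \<exists>c d. K = cbox c d"
    "pairwise (\<lambda>A B. interior A \<inter> interior B = {}) \<D>"
    "\<forall>K\<in>\<D>. \<exists>x\<in>U \<inter> K. K \<subseteq> \<gamma> x"
    "\<forall>u v. cbox u v \<in> \<D> \<longrightarrow> (\<exists>n. \<forall>i\<in>Basis. v \<bullet> i - u \<bullet> i = 2 / 2 ^ n)"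
    "U \<subseteq> \<Union>\<D>"
    by (elim exE conjE)
  have "\<forall>K\<in>\<D>. \<exists>x. \<exists>u v l. x \<in> U \<and> K = cbox u v \<and> K \<subseteq> ball x (\<delta> x) \<and> 0 < l \<and>
      (\<forall>i\<in>Basis. v \<bullet> i - u \<bullet> i = l)"
  proof
    fix K assume K: "K \<in> \<D>"
    obtain u v where uv: "K = cbox u v" using \<D>(2) K by blast
    obtain n where "\<forall>i\<in>Basis. v \<bullet> i - u \<bullet> i = 2 / 2 ^ n"
      using \<D>(5) K uv by blast
    moreover obtain x where "x \<in> U" "K \<subseteq> ball x (\<delta> x)"
      using \<D>(4) K by (auto simp: \<gamma>_def)
    ultimately show "\<exists>x. \<exists>u v l. x \<in> U \<and> K = cbox u v \<and> K \<subseteq> ball x (\<delta> x) \<and> 0 < l \<and>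
      (\<forall>i\<in>Basis. v \<bullet> i - u \<bullet> i = l)"
      using uv by (intro exI[of _ x] exI[of _ u] exI[of _ v] exI[of _ "2/2^n"]) auto
  qed
  from bchoice[OF this] obtain X where X: "\<forall>K\<in>\<D>. \<exists>u v l. X K \<in> U \<and> K = cbox u v \<and> K \<subseteq> ball (X K) (\<delta> (X K)) \<and> 0 < l \<and>
      (\<forall>i\<in>Basis. v \<bullet> i - u \<bullet> i = l)" ..
  define slopes where "slopes K = {p. \<exists>x\<in>K. contact x p}" for K
  \<comment> \<open>All slopes over a cube lie within \<open>\<rho>\<close> of any one of them, so a
    single ball encloses them. Its volume is proportional to that of the cube because the sides of
    the cube are equal.\<close>
  have ball: "\<exists>C. C \<in> sets lborel \<and> slopes K \<subseteq> C \<and>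
     emeasure lborel C \<le> (\<integral>\<^sup>+x. indicator (interior K) x * ennreal (unit_ball_vol (real ?d) * (2 * c * ?d) ^ ?d * F x ^ ?d) \<partial>lborel)"
    if K: "K \<in> \<D>" for K
  proof -
    obtain u v l where uvl: "X K \<in> U" "K = cbox u v" "K \<subseteq> ball (X K) (\<delta> (X K))" "0 < l"
      "\<And>i. i \<in> Basis \<Longrightarrow> v \<bullet> i - u \<bullet> i = l"
      using bspec[OF X K] by (elim exE conjE) (metis (full_types))
    let ?x = "X K"
    have ne: "u \<in> K" "v \<in> K" using uvl by (auto simp: mem_box) (smt (verit))+
    have diam: "dist y z \<le> ?d * l" if "y \<in> K" "z \<in> K" for y z
    proof -
      have "dist y z \<le> (\<Sum>i\<in>Basis. \<bar>(y - z) \<bullet> i\<bar>)"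
        unfolding dist_norm by (rule norm_le_l1)
      also have "\<dots> \<le> (\<Sum>i\<in>(Basis::'a set). l)"
      proof (intro sum_mono)
        fix i :: 'a assume i: "i \<in> Basis"
        then show "\<bar>(y - z) \<bullet> i\<bar> \<le> l"
          using that uvl(2) uvl(5)[OF i] by (auto simp: mem_box inner_diff_left abs_le_iff) (smt (verit) i)+
      qed
      finally show ?thesis by simp
    qed
    obtain i :: 'a where i: "i \<in> Basis" using nonempty_Basis by blast
    have "l = (v - u) \<bullet> i" using uvl(5)[OF i] by (simp add: inner_diff_left)
    also have "\<dots> \<le> norm (v - u)" using Basis_le_norm[OF i, of "v - u"] by linarith
    also have "\<dots> \<le> dist ?x v + dist ?x u" using norm_triangle_ineq4[of "v - ?x" "u - ?x"]
      by (simp add: dist_norm norm_minus_commute)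
    also have "\<dots> < 2 * \<delta> ?x" using uvl(3) ne by (auto simp: subset_iff) (smt (verit) mem_ball)
    finally have l: "?d * l < 2 * real ?d * \<delta> ?x" by simp
    have dl: "0 < ?d * l" using uvl(4) by simp
    define \<rho> where "\<rho> = c * F ?x * (?d * l)"
    have F0: "0 < F ?x" using F uvl(1) by blast
    have \<rho>: "0 \<le> \<rho>" using c F0 uvl(4) by (simp add: \<rho>_def)
    have sl: "\<exists>q. slopes K \<subseteq> cball q \<rho>"
    proof (cases "slopes K = {}")
      case False
      then obtain q y where q: "y \<in> K" "contact y q" by (auto simp: slopes_def)
      have "slopes K \<subseteq> cball q \<rho>"
      proof
        fix p assume "p \<in> slopes K"
        then obtain z where z: "z \<in> K" "contact z p" by (auto simp: slopes_def)
        have "norm (p - q) \<le> c * F ?x * (?d * l)"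
          using \<delta>4[OF uvl(1) _ _ q(2) z(2) diam[OF q(1) z(1)] dl l] uvl(3) q z by blast
        then show "p \<in> cball q \<rho>" by (simp add: \<rho>_def dist_norm norm_minus_commute)
      qed
      then show ?thesis by blast
    qed auto
    then obtain q where q: "slopes K \<subseteq> cball q \<rho>" by blast
    have vol: "emeasure lborel (interior K) = ennreal (l ^ ?d)"
    proof -
      have "emeasure lborel (box u v) = ennreal (\<Prod>i\<in>Basis. (v - u) \<bullet> i)"
        using uvl by (intro emeasure_lborel_box) (smt (verit))
      also have "(\<Prod>i\<in>Basis. (v - u) \<bullet> i) = (\<Prod>i\<in>(Basis::'a set). l)"
        using uvl(5) by (intro prod.cong) (auto simp: inner_diff_left)
      finally show ?thesis using uvl(2) by simp
    qed
    \<comment> \<open>The constant is arranged as \<open>(2 * c * d) ^ d * (F x / 2) ^ d\<close>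
      because \<open>F x / 2\<close> is a lower bound for \<open>F\<close> on the whole
      cube.\<close>
    have "emeasure lborel (cball q \<rho>) = ennreal (unit_ball_vol ?d * (2 * c * ?d) ^ ?d * (F ?x / 2) ^ ?d) * ennreal (l ^ ?d)"
      using \<rho> c F0 uvl(4)
      by (simp add: emeasure_cball \<rho>_def power_mult_distrib power_divide algebra_simps flip: ennreal_mult)
    also have "\<dots> = (\<integral>\<^sup>+x. ennreal (unit_ball_vol ?d * (2 * c * ?d) ^ ?d * (F ?x / 2) ^ ?d) * indicator (interior K) x \<partial>lborel)"
      by (subst nn_integral_cmult_indicator) (simp_all add: vol)
    also have "\<dots> \<le> (\<integral>\<^sup>+x. indicator (interior K) x * ennreal (unit_ball_vol (real ?d) * (2 * c * ?d) ^ ?d * F x ^ ?d) \<partial>lborel)"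
    proof (intro nn_integral_mono)
      fix y
      show "ennreal (unit_ball_vol ?d * (2 * c * ?d) ^ ?d * (F ?x / 2) ^ ?d) * indicator (interior K) y
         \<le> indicator (interior K) y * ennreal (unit_ball_vol (real ?d) * (2 * c * ?d) ^ ?d * F y ^ ?d)"
      proof (cases "y \<in> interior K")
        case True
        then have "F ?x \<le> 2 * F y"
          using \<delta>(3)[OF uvl(1)] uvl(3) interior_subset by blast
        then have "(F ?x / 2) ^ ?d \<le> F y ^ ?d"
          using F0 by (intro power_mono) auto
        then show ?thesis
          using True c by (auto intro!: ennreal_leI mult_left_mono)
      qed simp
    qed
    finally show ?thesis using q by (intro exI[of _ "cball q \<rho>"]) auto
  qed
  then have "\<forall>K\<in>\<D>. \<exists>C. C \<in> sets lborel \<and> slopes K \<subseteq> C \<and>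
     emeasure lborel C \<le> (\<integral>\<^sup>+x. indicator (interior K) x * ennreal (unit_ball_vol (real ?d) * (2 * c * ?d) ^ ?d * F x ^ ?d) \<partial>lborel)"
    by blast
  from bchoice[OF this] obtain C where q: "\<forall>K\<in>\<D>. C K \<in> sets lborel \<and> slopes K \<subseteq> C K \<and>
     emeasure lborel (C K) \<le> (\<integral>\<^sup>+x. indicator (interior K) x * ennreal (unit_ball_vol (real ?d) * (2 * c * ?d) ^ ?d * F x ^ ?d) \<partial>lborel)" ..
  show ?thesis
  proof (rule emeasure_countable_charge[where D = \<D> and A = interior and B = "C"])
    show "disjoint_family_on interior \<D>"
      using \<D>(3) by (auto simp: disjoint_family_on_def pairwise_def)
    show "interior K \<subseteq> U" if K: "K \<in> \<D>" for K
      using bspec[OF X K] \<delta>(2) interior_subset by blast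
    show "T \<subseteq> (\<Union>K\<in>\<D>. C K)"
    proof
      fix p assume "p \<in> T"
      then obtain x where x: "x \<in> U" "contact x p" using T by blast
      then obtain K where K: "K \<in> \<D>" "x \<in> K" using \<D>(6) by blast
      then have "p \<in> slopes K" using x by (auto simp: slopes_def)
      then show "p \<in> (\<Union>K\<in>\<D>. C K)" using q K by blast
    qed
    have "(\<lambda>x. indicator U x *\<^sub>R (unit_ball_vol (real ?d) * (2 * c * ?d) ^ ?d * F x ^ ?d)) \<in> borel_measurable borel"
      using U F by (intro borel_measurable_continuous_on_indicator continuous_intros) auto
    then have "(\<lambda>x. ennreal (indicator U x *\<^sub>R (unit_ball_vol (real ?d) * (2 * c * ?d) ^ ?d * F x ^ ?d))) \<in> borel_measurable borel"
      by measurable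
    moreover have "ennreal (indicator U x *\<^sub>R (unit_ball_vol (real ?d) * (2 * c * ?d) ^ ?d * F x ^ ?d)) =
       indicator U x * ennreal (unit_ball_vol (real ?d) * (2 * c * ?d) ^ ?d * F x ^ ?d)" for x
      by (simp add: indicator_def)
    ultimately show "(\<lambda>x. indicator U x * ennreal (unit_ball_vol (real ?d) * (2 * c * ?d) ^ ?d * F x ^ ?d))
      \<in> borel_measurable lborel" by simp
  qed (use \<D>(1) q in auto)
qed

section \<open>The barrier\<close>

lemma C2_on_affine: "C2_on U (\<lambda>y. q \<bullet> y + c) (\<lambda>y. q) (\<lambda>y v. 0)"
  unfolding C2_on_def by (auto intro!: derivative_eq_intros)

lemma C2_on_affine_square:
  "C2_on U (\<lambda>y. (q \<bullet> y + c)\<^sup>2) (\<lambda>y. (2 * (q \<bullet> y + c)) *\<^sub>R q) (\<lambda>y v. (2 * (q \<bullet> v)) *\<^sub>R q)"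
  unfolding C2_on_def
  by (auto intro!: derivative_eq_intros continuous_intros ext simp: power2_eq_square algebra_simps)

lemma C2_on_norm_square:
  "C2_on U (\<lambda>y. (norm (y - x0))\<^sup>2) (\<lambda>y. 2 *\<^sub>R (y - x0)) (\<lambda>y v. 2 *\<^sub>R v)"
  unfolding C2_on_def power2_norm_eq_inner
  by (auto intro!: derivative_eq_intros continuous_intros ext simp: inner_commute algebra_simps)

lemma C2_on_fst_norm_square:
  "C2_on U (\<lambda>y. (norm (fst y - z))\<^sup>2) (\<lambda>y. (2 *\<^sub>R (fst y - z), 0::real)) (\<lambda>y v. (2 *\<^sub>R fst v, 0))"
  unfolding C2_on_def power2_norm_eq_inner
  by (auto intro!: derivative_eq_intros continuous_intros ext simp: inner_commute inner_prod_def algebra_simps)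

lemma C2_on_affine_powr:
  assumes "\<And>y. y \<in> U \<Longrightarrow> 0 < q \<bullet> y + c"
  shows "C2_on U (\<lambda>y. (q \<bullet> y + c) powr s) (\<lambda>y. (s * (q \<bullet> y + c) powr (s - 1)) *\<^sub>R q)
     (\<lambda>y v. (s * (s - 1) * (q \<bullet> y + c) powr (s - 2) * (q \<bullet> v)) *\<^sub>R q)"
  unfolding C2_on_def
proof (intro conjI ballI allI)
  fix y assume y: "y \<in> U"
  have D: "((\<lambda>y. (q \<bullet> y + c) powr s) has_derivative (\<lambda>h. (s * (q \<bullet> y + c) powr (s - 1)) * (q \<bullet> h))) (at y)" for s
  proof -
    have "((\<lambda>t. t powr s) has_real_derivative s * (q \<bullet> y + c) powr (s - 1)) (at (q \<bullet> y + c))"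
      using assms[OF y] by (rule has_real_derivative_powr)
    moreover have "((\<lambda>y. q \<bullet> y + c) has_derivative (\<lambda>h. q \<bullet> h)) (at y)"
      by (auto intro!: derivative_eq_intros)
    ultimately show ?thesis
      using has_derivative_compose[of "\<lambda>y. q \<bullet> y + c" "\<lambda>h. q \<bullet> h" y UNIV "\<lambda>t. t powr s"]
      by (simp add: has_field_derivative_def)
  qed
  show "((\<lambda>y. (q \<bullet> y + c) powr s) has_derivative (\<lambda>h. ((s * (q \<bullet> y + c) powr (s - 1)) *\<^sub>R q) \<bullet> h)) (at y)"
    using D by simp
  show "((\<lambda>y. (s * (q \<bullet> y + c) powr (s - 1)) *\<^sub>R q) has_derivative
      (\<lambda>v. (s * (s - 1) * (q \<bullet> y + c) powr (s - 2) * (q \<bullet> v)) *\<^sub>R q)) (at y)"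
    using has_derivative_scaleR_left[OF has_derivative_mult_right[OF D[of "s - 1"], of s], of q]
    by (simp add: algebra_simps)
next
  fix v
  show "continuous_on U (\<lambda>y. (s * (s - 1) * (q \<bullet> y + c) powr (s - 2) * (q \<bullet> v)) *\<^sub>R q)"
    using assms by (intro continuous_intros) (auto simp: less_le)
qed

lemma C2_on_add:
  assumes "C2_on U f G H" "C2_on U f' G' H'"
  shows "C2_on U (\<lambda>y. f y + f' y) (\<lambda>y. G y + G' y) (\<lambda>y v. H y v + H' y v)"
proof -
  have *: "(\<bullet>) (G y + G' y) = (\<lambda>h. G y \<bullet> h + G' y \<bullet> h)" for y
    by (simp add: fun_eq_iff inner_add_left)
  show ?thesis
    using assms unfolding C2_on_def
    by (auto simp: * intro!: has_derivative_add continuous_on_add)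
qed

lemma C2_on_cmult:
  assumes "C2_on U f G H"
  shows "C2_on U (\<lambda>y. k * f y) (\<lambda>y. k *\<^sub>R G y) (\<lambda>y v. k *\<^sub>R H y v)"
proof -
  have *: "(\<bullet>) (k *\<^sub>R G y) = (\<lambda>h. k * (G y \<bullet> h))" for y
    by (simp add: fun_eq_iff)
  show ?thesis
    using assms unfolding C2_on_def
    by (auto simp: * intro!: has_derivative_mult_right has_derivative_scaleR_right continuous_intros)
qed

lemma C2_on_subset: "C2_on U f G H \<Longrightarrow> S \<subseteq> U \<Longrightarrow> C2_on S f G H"
  unfolding C2_on_def by (meson continuous_on_subset subsetD)

text \<open>Concavity of the power, obtained from weighted AM-GM applied to \<open>s / t\<close> and
  \<open>1\<close> and scaled by \<open>t powr p\<close>. At \<open>s = 0\<close>, where both powers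
  of \<open>s\<close> vanish, the claim reduces to \<open>p \<le> 1\<close>.\<close>

lemma powr_le_tangent:
  fixes s t p :: real
  assumes "0 \<le> s" "0 < t" "0 < p" "p < 1"
  shows "s powr p \<le> t powr p + p * t powr (p - 1) * (s - t)"
proof (cases "s = 0")
  case True
  have "t powr p = t powr (p - 1) * t"
    using assms by (simp add: powr_diff)
  moreover have "p * (t powr (p - 1) * t) \<le> 1 * (t powr (p - 1) * t)"
    using assms by (intro mult_right_mono) auto
  ultimately show ?thesis
    using True assms by (simp add: algebra_simps)
next
  case False
  have "(s / t) powr p * 1 powr (1 - p) \<le> p * (s / t) + (1 - p) * 1"
    using assms False by (intro Youngs_inequality_0) auto
  then have "t powr p * (s / t) powr p \<le> t powr p * (p * (s / t) + (1 - p))"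
    by (intro mult_left_mono) auto
  moreover have "t powr p * (s / t) powr p = s powr p"
    using assms by (simp add: powr_divide)
  moreover have "t powr p * (p * (s / t) + (1 - p)) = t powr p + p * t powr (p - 1) * (s - t)"
  proof -
    have "t powr (p - 1) = t powr p / t"
      using assms by (simp add: powr_diff)
    then show ?thesis using assms by (simp only:) (simp add: field_simps)
  qed
  ultimately show ?thesis by linarith
qed

section \<open>The tangent-plane barriers and their signs\<close>

definition tangent_height :: "('m::euclidean_space \<Rightarrow> real) \<Rightarrow> ('m \<Rightarrow> 'm) \<Rightarrow> 'm \<Rightarrow> 'm \<times> real \<Rightarrow> real" where
  "tangent_height Psi G z x = snd x - Psi z - G z \<bullet> (fst x - z)"

text \<open>The first term is the kink. The \<open>B\<close> term outweighs the gap between graph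
  and tangent plane; the squared height inside it keeps its second derivatives below a multiple of
  \<open>\<bar>L\<bar> powr (\<alpha> - 1)\<close>. The \<open>D\<close> term cancels those in the
  normal direction, and the \<open>N\<close> term repairs, away from \<open>z\<close>, the loss that
  the \<open>D\<close> term causes on the graph.\<close>

definition barrier :: "('m::euclidean_space \<Rightarrow> real) \<Rightarrow> ('m \<Rightarrow> 'm) \<Rightarrow> real \<Rightarrow> real \<Rightarrow> real \<Rightarrow> real
    \<Rightarrow> 'm \<Rightarrow> 'm \<times> real \<Rightarrow> real" where
  "barrier Psi G \<alpha> B N D z x =
     - \<bar>tangent_height Psi G z x\<bar>
     + B * ((norm (fst x - z))\<^sup>2 + (tangent_height Psi G z x)\<^sup>2) powr ((1 + \<alpha>) / 2)
     + N * (norm (fst x - z))\<^sup>2 - D * \<bar>tangent_height Psi G z x\<bar> powr (1 + \<alpha>)"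

lemma square_powr_half: "(t\<^sup>2) powr (s / 2) = \<bar>t\<bar> powr s" for s t :: real
proof -
  have "(t\<^sup>2) powr (s / 2) = (\<bar>t\<bar> powr 2) powr (s / 2)"
    by (simp add: powr_numeral)
  also have "\<dots> = \<bar>t\<bar> powr s" by (simp only: powr_powr) simp
  finally show ?thesis .
qed

text \<open>With base point below or above \<open>x\<close> the horizontal offset vanishes, and the
  \<open>B\<close> and \<open>D\<close> terms become the same power of the vertical
  distance.\<close>

lemma barrier_vertical_le:
  assumes "B \<le> D"
  shows "barrier Psi G \<alpha> B N D (fst x) x \<le> - \<bar>snd x - Psi (fst x)\<bar>"
  using mult_right_mono[OF assms, of "\<bar>snd x - Psi (fst x)\<bar> powr (1 + \<alpha>)"]
  by (simp add: barrier_def tangent_height_def square_powr_half)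

text \<open>This rules out the artificial kinks: by \<open>barrier_vertical_le\<close> a minimising
  \<open>z\<close> has a negative barrier value off the interface, so the point cannot lie on the
  kink plane of that \<open>z\<close>.\<close>

lemma barrier_nonneg_on_tangent:
  assumes "tangent_height Psi G z x = 0" "0 \<le> B" "0 \<le> N" "-1 < \<alpha>"
  shows "0 \<le> barrier Psi G \<alpha> B N D z x"
  using assms by (simp add: barrier_def)

text \<open>On the graph \<open>\<bar>L\<bar> \<le> K * r powr (1 + \<alpha>)\<close>. Of the
  coefficient \<open>K + 1\<close>, the part \<open>K\<close> pays for
  \<open>- \<bar>L\<bar>\<close>. The remaining \<open>1\<close> pays for the \<open>D\<close> term
  at small \<open>r\<close>, where that term is of higher order, and \<open>N\<close> pays at larger
  \<open>r\<close>.\<close>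

lemma barrier_nonneg_on_graph:
  fixes Psi :: "'m::euclidean_space \<Rightarrow> real"
  assumes \<alpha>: "0 < \<alpha>" and K: "0 \<le> K" and D: "0 \<le> D"
    and taylor: "\<And>x z. x \<in> cball 0 1 \<Longrightarrow> z \<in> cball 0 1
        \<Longrightarrow> \<bar>Psi x - Psi z - G z \<bullet> (x - z)\<bar> \<le> K * norm (x - z) powr (1 + \<alpha>)"
  shows "\<exists>N\<ge>0. \<forall>x z. fst x \<in> cball 0 1 \<longrightarrow> z \<in> cball 0 1 \<longrightarrow> snd x = Psi (fst x)
     \<longrightarrow> 0 \<le> barrier Psi G \<alpha> (K + 1) N D z x"
proof -
  \<comment> \<open>On the graph the \<open>D\<close> term is at most
    \<open>\<kappa> * r powr (1 + \<alpha> + s)\<close>, since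
    \<open>(1 + \<alpha>) * (1 + \<alpha>) = 1 + \<alpha> + s\<close>. The radius \<open>r1\<close>
    solves \<open>(\<kappa> + 1) * r powr s = 1\<close>, and \<open>N\<close> makes the quadratic
    dominate from \<open>r1\<close> up to \<open>2\<close>, the diameter of the ball.\<close>
  define \<kappa> where "\<kappa> = D * K powr (1 + \<alpha>)"
  define s where "s = \<alpha> * (1 + \<alpha>)"
  define r1 where "r1 = (1 / (\<kappa> + 1)) powr (1 / s)"
  define N where "N = \<kappa> * 2 powr (1 + \<alpha> + s) / r1\<^sup>2"
  have \<kappa>: "0 \<le> \<kappa>" using D by (simp add: \<kappa>_def)
  have s: "0 < s" using \<alpha> by (simp add: s_def)
  have r1: "0 < r1" using \<kappa> by (simp add: r1_def)
  have N: "0 \<le> N" using \<kappa> by (simp add: N_def)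
  have key: "\<kappa> * r powr (1 + \<alpha> + s) \<le> r powr (1 + \<alpha>) + N * r\<^sup>2" if r: "0 \<le> r" "r \<le> 2" for r
  proof (cases "r \<le> r1")
    case True
    have "r powr s \<le> r1 powr s" using True r s by (intro powr_mono2) auto
    also have "\<dots> = 1 / (\<kappa> + 1)" using s \<kappa> by (simp add: r1_def powr_powr)
    finally have "\<kappa> * r powr s \<le> \<kappa> * (1 / (\<kappa> + 1))" using \<kappa> by (intro mult_left_mono)
    also have "\<dots> \<le> 1" using \<kappa> by (simp add: field_simps)
    finally have "(\<kappa> * r powr s) * r powr (1 + \<alpha>) \<le> 1 * r powr (1 + \<alpha>)"
      by (intro mult_right_mono) auto
    moreover have "0 \<le> N * r\<^sup>2" using N by simp
    ultimately show ?thesis by (simp add: powr_add algebra_simps)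
  next
    case False
    have "\<kappa> * r powr (1 + \<alpha> + s) \<le> \<kappa> * 2 powr (1 + \<alpha> + s)"
      using r \<alpha> s \<kappa> by (intro mult_left_mono powr_mono2) auto
    also have "\<dots> = N * r1\<^sup>2" using r1 by (simp add: N_def)
    also have "\<dots> \<le> N * r\<^sup>2" using False r1 N by (intro mult_left_mono power_mono) auto
    finally show ?thesis by (simp add: add_increasing)
  qed
  show ?thesis
  proof (intro exI[of _ N] conjI N allI impI)
    fix x :: "'m \<times> real" and z :: 'm
    assume x: "fst x \<in> cball 0 1" and z: "z \<in> cball 0 1" and eq: "snd x = Psi (fst x)"
    define r where "r = norm (fst x - z)"
    define L where "L = tangent_height Psi G z x"
    have r: "0 \<le> r" "r \<le> 2"
      using x z norm_triangle_ineq4[of "fst x" z] by (auto simp: r_def)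
    have L: "\<bar>L\<bar> \<le> K * r powr (1 + \<alpha>)"
      using taylor[OF x z] by (simp add: L_def tangent_height_def eq r_def)
    have "D * \<bar>L\<bar> powr (1 + \<alpha>) \<le> D * (K * r powr (1 + \<alpha>)) powr (1 + \<alpha>)"
      using L D \<alpha> by (intro mult_left_mono powr_mono2) auto
    also have "\<dots> = \<kappa> * r powr (1 + \<alpha> + s)"
      using K r by (simp add: \<kappa>_def s_def powr_mult powr_powr algebra_simps)
    finally have a: "D * \<bar>L\<bar> powr (1 + \<alpha>) \<le> r powr (1 + \<alpha>) + N * r\<^sup>2"
      using key[OF r] by linarith
    have "(r\<^sup>2) powr ((1 + \<alpha>) / 2) \<le> (r\<^sup>2 + L\<^sup>2) powr ((1 + \<alpha>) / 2)"
      using \<alpha> by (intro powr_mono2) auto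
    then have "r powr (1 + \<alpha>) \<le> (r\<^sup>2 + L\<^sup>2) powr ((1 + \<alpha>) / 2)"
      using r by (simp add: square_powr_half)
    then have "(K + 1) * r powr (1 + \<alpha>) \<le> (K + 1) * (r\<^sup>2 + L\<^sup>2) powr ((1 + \<alpha>) / 2)"
      using K by (intro mult_left_mono) auto
    then show "0 \<le> barrier Psi G \<alpha> (K + 1) N D z x"
      using a L by (simp add: barrier_def r_def L_def algebra_simps)
  qed
qed

lemma orthonormal_basis_sum_norm_square:
  fixes B :: "'a::euclidean_space set"
  assumes "orthonormal_basis B"
  shows "(\<Sum>v\<in>B. (norm v)\<^sup>2) = DIM('a)"
  using assms by (simp add: orthonormal_basis_def)

lemma orthonormal_basis_sum_norm_fst_le:
  fixes B :: "('m::euclidean_space \<times> real) set"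
  assumes "orthonormal_basis B"
  shows "(\<Sum>v\<in>B. (norm (fst v))\<^sup>2) \<le> DIM('m \<times> real)"
proof -
  have "(norm (fst v))\<^sup>2 \<le> (norm v)\<^sup>2" for v :: "'m \<times> real"
    using norm_fst_le[of "fst v" "snd v"] by (simp add: power_mono)
  then have "(\<Sum>v\<in>B. (norm (fst v))\<^sup>2) \<le> (\<Sum>v\<in>B. (norm v)\<^sup>2)"
    by (intro sum_mono)
  then show ?thesis using orthonormal_basis_sum_norm_square[OF assms] by simp
qed

text \<open>The tangent line of the concave power in \<^const>\<open>barrier\<close> replaces the singular term by a
  quadratic one; its Hessian blows up like \<open>\<bar>L\<bar> powr (\<alpha> - 1)\<close> at most, which the concave term
  \<open>- D * \<bar>L\<bar> powr (1 + \<alpha>)\<close> absorbs in the normal direction.\<close>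
lemma barrier_touching:
  fixes Psi :: "'m::euclidean_space \<Rightarrow> real" and x0 :: "'m \<times> real" and z :: 'm
    and lam Lam \<alpha> B N D :: real
  assumes lam: "0 < lam" "lam \<le> Lam" and \<alpha>: "0 < \<alpha>" "\<alpha> < 1" and B: "0 \<le> B" and N: "0 \<le> N"
    and D: "D = Lam * B * (DIM('m \<times> real) + 1) / (lam * \<alpha>)"
    and L0: "tangent_height Psi G z x0 \<noteq> 0"
  obtains r W GW HW P Q where "0 < r" "C2_on (ball x0 r) W GW HW" "W x0 = barrier Psi G \<alpha> B N D z x0"
    "\<And>y. y \<in> ball x0 r \<Longrightarrow> barrier Psi G \<alpha> B N D z y \<le> W y"
    "linear (HW x0)" "\<And>x y. x \<bullet> HW x0 y = HW x0 x \<bullet> y"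
    "\<And>v. v \<bullet> HW x0 v = Q v - P v" "\<And>v. 0 \<le> P v" "\<And>v. 0 \<le> Q v"
    "\<And>S. orthonormal_basis S \<Longrightarrow> - (2 * N * Lam * DIM('m \<times> real)) \<le> lam * (\<Sum>v\<in>S. P v) - Lam * (\<Sum>v\<in>S. Q v)"
proof -
  define d where "d = real (DIM('m \<times> real))"
  define n where "n = (- G z, 1::real)"
  define c where "c = G z \<bullet> z - Psi z"
  \<comment> \<open>Freezing the sign of the height at \<open>x0\<close> gives an affine
    \<open>l\<close> that equals the absolute height on the small ball where \<open>l\<close> is
    positive.\<close>
  define \<sigma> where "\<sigma> = sgn (tangent_height Psi G z x0)"
  have Lf: "tangent_height Psi G z y = n \<bullet> y + c" for y
    by (simp add: tangent_height_def n_def c_def inner_prod_def inner_diff_right)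
  have \<sigma>: "\<sigma> * \<sigma> = 1" "\<bar>\<sigma>\<bar> = 1" using L0 by (auto simp: \<sigma>_def sgn_if)
  define l where "l y = (\<sigma> *\<^sub>R n) \<bullet> y + \<sigma> * c" for y
  have lL: "l y = \<sigma> * tangent_height Psi G z y" for y
    by (simp add: l_def Lf algebra_simps)
  have l0: "0 < l x0" using L0 by (auto simp: lL \<sigma>_def sgn_if)
  define S where "S y = (norm (fst y - z))\<^sup>2 + (n \<bullet> y + c)\<^sup>2" for y
  define S0 where "S0 = S x0"
  define p where "p = (1 + \<alpha>) / 2"
  have p: "0 < p" "p < 1" using \<alpha> by (auto simp: p_def)
  have Sl: "(l x0)\<^sup>2 \<le> S0"
    using \<sigma> by (simp add: S0_def S_def lL Lf power_mult_distrib power2_eq_square[of \<sigma>])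
  then have S0: "0 < S0" using l0 by (smt (verit) zero_less_power)
  \<comment> \<open>The slope at \<open>S0\<close> of the concave power; its tangent line turns the
    \<open>B\<close> term into a multiple of the quadratic \<open>S\<close>.\<close>
  define m where "m = p * S0 powr (p - 1)"
  define W where "W y = - 1 * l y + (- D) * l y powr (1 + \<alpha>) + (B * m) * S y
      + (0 \<bullet> y + B * (S0 powr p - m * S0)) + N * (norm (fst y - z))\<^sup>2" for y
  have cont: "continuous_on UNIV l" unfolding l_def by (intro continuous_intros)
  have "open {y. 0 < l y}" using cont by (intro open_Collect_less) (auto intro: continuous_intros)
  then obtain r where r: "0 < r" "ball x0 r \<subseteq> {y. 0 < l y}"
    using l0 open_contains_ball by (metis mem_Collect_eq)
  note C2l = C2_on_affine[of "ball x0 r" "\<sigma> *\<^sub>R n" "\<sigma> * c", folded l_def]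
  have pos: "0 < (\<sigma> *\<^sub>R n) \<bullet> y + \<sigma> * c" if "y \<in> ball x0 r" for y
    using r that by (auto simp: l_def)
  note C2p = C2_on_affine_powr[of "ball x0 r" "\<sigma> *\<^sub>R n" "\<sigma> * c" "1 + \<alpha>", OF pos, folded l_def]
  note C2S = C2_on_add[OF C2_on_fst_norm_square[of "ball x0 r" z] C2_on_affine_square[of "ball x0 r" n c], folded S_def]
  note C2W = C2_on_add[OF C2_on_add[OF C2_on_add[OF C2_on_add[OF C2_on_cmult[OF C2l, of "-1"]
      C2_on_cmult[OF C2p, of "- D"]] C2_on_cmult[OF C2S, of "B * m"]]
      C2_on_affine[of "ball x0 r" 0 "B * (S0 powr p - m * S0)"]] C2_on_cmult[OF C2_on_fst_norm_square[of "ball x0 r" z], of N], folded W_def]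
  define a1 where "a1 = D * ((1 + \<alpha>) * \<alpha> * l x0 powr (\<alpha> - 1))"
  define HW where "HW = (\<lambda>(y::'m \<times> real) v.
       (- 1) *\<^sub>R (0::'m \<times> real) + (- D) *\<^sub>R ((1 + \<alpha>) * (1 + \<alpha> - 1) * l y powr (1 + \<alpha> - 2) * (\<sigma> *\<^sub>R n \<bullet> v)) *\<^sub>R \<sigma> *\<^sub>R n
       + (B * m) *\<^sub>R ((2 *\<^sub>R fst v, 0::real) + (2 * (n \<bullet> v)) *\<^sub>R n) + 0 + N *\<^sub>R (2 *\<^sub>R fst v, 0))"
  have HWx0: "HW x0 v = - ((a1 * (n \<bullet> v)) *\<^sub>R n) + (2 * B * m) *\<^sub>R ((fst v, 0) + (n \<bullet> v) *\<^sub>R n) + (2 * N) *\<^sub>R (fst v, 0)" for v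
  proof -
    have "\<sigma> = 1 \<or> \<sigma> = - 1" using L0 by (auto simp: \<sigma>_def sgn_if)
    then show ?thesis
      by (auto simp: HW_def a1_def scaleR_add_right algebra_simps)
  qed
  \<comment> \<open>Viscosity tests use \<open>- W\<close>, whose Hessian form is
    \<open>P - Q\<close>: the concave power supplies the favourable \<open>P\<close>, and the
    quadratics supply \<open>Q\<close>.\<close>
  define P where "P v = a1 * (n \<bullet> v)\<^sup>2" for v
  define Q where "Q v = 2 * B * m * ((norm (fst v))\<^sup>2 + (n \<bullet> v)\<^sup>2) + 2 * N * (norm (fst v))\<^sup>2" for v :: "'m \<times> real"
  have D0: "0 \<le> D" using D lam \<alpha> B by simp
  have a1: "0 \<le> a1" using D0 \<alpha> by (simp add: a1_def)
  have m: "0 \<le> m" using p by (simp add: m_def)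
  show thesis
  proof (rule that[OF r(1) C2W[folded HW_def]])
    show "W x0 = barrier Psi G \<alpha> B N D z x0"
    proof -
      have "\<bar>tangent_height Psi G z x0\<bar> = l x0"
        by (auto simp: lL \<sigma>_def sgn_if)
      then show ?thesis
        by (simp add: W_def barrier_def p_def S0_def[symmetric] Lf flip: S_def) (simp add: S0_def algebra_simps)
    qed
  next
    fix y assume "y \<in> ball x0 r"
    then have "0 < l y" using r by auto
    then have "\<bar>tangent_height Psi G z y\<bar> = l y"
      using \<sigma>(2) by (metis abs_mult abs_of_pos lL mult_1)
    moreover have "S y powr p \<le> S0 powr p + m * (S y - S0)"
      unfolding m_def using p S0 by (intro powr_le_tangent) (auto simp: S_def)
    then have "B * S y powr p \<le> B * (S0 powr p + m * (S y - S0))"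
      using B by (rule mult_left_mono)
    ultimately show "barrier Psi G \<alpha> B N D z y \<le> W y"
      by (simp add: W_def barrier_def p_def[symmetric] Lf flip: S_def) (simp add: algebra_simps)
  next
    show "linear (HW x0)"
      by (rule linearI) (simp_all add: HWx0 inner_add_right algebra_simps scaleR_add_right)
    show "x \<bullet> HW x0 y = HW x0 x \<bullet> y" for x y
      by (simp add: HWx0 inner_add_right inner_add_left inner_commute inner_prod_def algebra_simps)
    show "v \<bullet> HW x0 v = Q v - P v" for v
      by (simp add: HWx0 P_def Q_def inner_add_right inner_commute power2_norm_eq_inner)
        (simp add: power2_eq_square inner_prod_def inner_commute algebra_simps)
    show "0 \<le> P v" "0 \<le> Q v" for v
      using a1 B m N by (auto simp: P_def Q_def)
  next
    fix S :: "('m \<times> real) set" assume S: "orthonormal_basis S"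
    have PS: "(\<Sum>v\<in>S. P v) = a1 * (norm n)\<^sup>2"
      using orthonormal_basis_parseval[OF S, of n] by (simp add: P_def flip: sum_distrib_left)
    have n1: "1 \<le> (norm n)\<^sup>2"
      by (simp add: n_def norm_Pair power2_norm_eq_inner)
    have fs: "(\<Sum>v\<in>S. (norm (fst v))\<^sup>2) \<le> d"
      unfolding d_def by (rule orthonormal_basis_sum_norm_fst_le[OF S])
    have "(\<Sum>v\<in>S. Q v) = 2 * B * m * ((\<Sum>v\<in>S. (norm (fst v))\<^sup>2) + (norm n)\<^sup>2) + 2 * N * (\<Sum>v\<in>S. (norm (fst v))\<^sup>2)"
      using orthonormal_basis_parseval[OF S, of n]
      by (simp add: Q_def sum.distrib flip: sum_distrib_left)
    also have "\<dots> \<le> 2 * B * m * (d + (norm n)\<^sup>2) + 2 * N * d"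
      using fs B m N by (intro add_mono mult_left_mono) auto
    also have "\<dots> \<le> 2 * B * m * ((d + 1) * (norm n)\<^sup>2) + 2 * N * d"
    proof -
      have "d * 1 \<le> d * (norm n)\<^sup>2" using n1 by (intro mult_left_mono) (auto simp: d_def)
      then have "d + (norm n)\<^sup>2 \<le> (d + 1) * (norm n)\<^sup>2" by (simp add: algebra_simps)
      then show ?thesis using B m by (intro add_right_mono mult_left_mono) auto
    qed
    finally have QS: "(\<Sum>v\<in>S. Q v) \<le> 2 * B * m * ((d + 1) * (norm n)\<^sup>2) + 2 * N * d" .
    \<comment> \<open>As \<open>S0\<close> is at least \<open>(l x0)\<^sup>2\<close> and the
      exponent is negative, the convex term is no more singular than the concave one. The choice of
      \<open>D\<close>, that is \<open>lam * \<alpha> * D = Lam * B * (d + 1)\<close>, then makes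
      the two balance, leaving only the \<open>N\<close> term.\<close>
    have "2 * m \<le> (1 + \<alpha>) * l x0 powr (\<alpha> - 1)"
    proof -
      have "S0 powr (p - 1) \<le> ((l x0)\<^sup>2) powr (p - 1)"
        using Sl l0 p by (intro powr_mono2') auto
      also have "\<dots> = l x0 powr (\<alpha> - 1)"
      proof -
        have "p - 1 = (\<alpha> - 1) / 2" by (simp add: p_def field_simps)
        show ?thesis unfolding \<open>p - 1 = (\<alpha> - 1) / 2\<close> square_powr_half using l0 by simp
      qed
      finally have "(1 + \<alpha>) * S0 powr (p - 1) \<le> (1 + \<alpha>) * l x0 powr (\<alpha> - 1)"
        using \<alpha> by (intro mult_left_mono) auto
      then show ?thesis by (simp add: m_def p_def)
    qed
    then have "Lam * B * (d + 1) * (norm n)\<^sup>2 * (2 * m) \<le> Lam * B * (d + 1) * (norm n)\<^sup>2 * ((1 + \<alpha>) * l x0 powr (\<alpha> - 1))"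
      using lam B by (intro mult_left_mono) (auto simp: d_def)
    also have "\<dots> = lam * (a1 * (norm n)\<^sup>2)"
      using lam \<alpha> by (simp add: a1_def D d_def)
    finally have "Lam * (2 * B * m * ((d + 1) * (norm n)\<^sup>2)) \<le> lam * (\<Sum>v\<in>S. P v)"
      unfolding PS by (simp add: algebra_simps)
    moreover have "Lam * (\<Sum>v\<in>S. Q v) \<le> Lam * (2 * B * m * ((d + 1) * (norm n)\<^sup>2)) + 2 * N * Lam * d"
      using mult_left_mono[OF QS, of Lam] lam by (simp add: algebra_simps)
    ultimately show "- (2 * N * Lam * DIM('m \<times> real)) \<le> lam * (\<Sum>v\<in>S. P v) - Lam * (\<Sum>v\<in>S. Q v)"
      by (simp add: d_def)
  qed
qed

section \<open>Contact with affine functions\<close>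

text \<open>Since \<open>W\<close> touches the barrier from above at \<open>x\<close>, the function
  \<open>\<psi> - k * W\<close> plus a constant touches \<open>u\<close> from below there. Its
  Hessian is \<open>2 * A\<close> times the projection onto \<open>e\<close>, minus
  \<open>2 * b\<close> times the identity, minus \<open>k\<close> times that of
  \<open>W\<close>.\<close>

lemma visc_super_barrier_test:
  fixes Psi :: "'m::euclidean_space \<Rightarrow> real" and x x0 q e :: "'m \<times> real" and z :: 'm
    and lam Lam \<alpha> B N D A b c k t \<rho> :: real
  assumes lam: "0 < lam" "lam \<le> Lam" and \<alpha>: "0 < \<alpha>" "\<alpha> < 1" and B: "0 \<le> B" and N: "0 \<le> N"
    and D: "D = Lam * B * (DIM('m \<times> real) + 1) / (lam * \<alpha>)"
    and L0: "tangent_height Psi G z x \<noteq> 0"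
    and visc: "visc_super lam Lam Psi a \<Omega> f u" and x: "x \<in> \<Omega>" and \<rho>: "0 < \<rho>" "ball x \<rho> \<subseteq> \<Omega>"
    and e: "norm e = 1" and A: "0 \<le> A" and b: "0 \<le> b" and k: "0 \<le> k"
    and \<psi>: "\<And>y. \<psi> y = (q \<bullet> y + c) + A * (e \<bullet> y + t)\<^sup>2 + (- b) * (norm (y - x0))\<^sup>2"
    and touch: "\<And>y. y \<in> ball x \<rho> \<Longrightarrow>
        u x + k * barrier Psi G \<alpha> B N D z x - \<psi> x \<le> u y + k * barrier Psi G \<alpha> B N D z y - \<psi> y"
  shows "weight Psi a x * (2 * A * lam - 2 * b * Lam * DIM('m \<times> real) - 2 * N * Lam * DIM('m \<times> real) * k) \<le> f x"
proof -
  let ?w = "barrier Psi G \<alpha> B N D z" and ?d = "real DIM('m \<times> real)"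
  obtain r W GW HW P Q where r: "0 < r" and C2: "C2_on (ball x r) W GW HW" and Wx: "W x = ?w x"
    and Wge: "\<And>y. y \<in> ball x r \<Longrightarrow> ?w y \<le> W y"
    and lin: "linear (HW x)" and sym: "\<And>v y. v \<bullet> HW x y = HW x v \<bullet> y"
    and PQ: "\<And>v. v \<bullet> HW x v = Q v - P v" "\<And>v. 0 \<le> P v" "\<And>v. 0 \<le> Q v"
    and PQsum: "\<And>S. orthonormal_basis S \<Longrightarrow> - (2 * N * Lam * ?d) \<le> lam * (\<Sum>v\<in>S. P v) - Lam * (\<Sum>v\<in>S. Q v)"
    by (rule barrier_touching[OF lam \<alpha> B N D L0]) (rule that)
  define s where "s = min r \<rho>"
  have s: "0 < s" "ball x s \<subseteq> ball x r" "ball x s \<subseteq> ball x \<rho>" using r \<rho> by (auto simp: s_def)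
  define c' where "c' = u x + k * ?w x - \<psi> x"
  define \<phi> where "\<phi> y = (q \<bullet> y + (c + c')) + A * (e \<bullet> y + t)\<^sup>2 + (- b) * (norm (y - x0))\<^sup>2 + (- k) * W y" for y
  note C2\<phi> = C2_on_add[OF C2_on_add[OF C2_on_add[OF C2_on_affine[of "ball x s" q "c + c'"]
      C2_on_cmult[OF C2_on_affine_square[of "ball x s" e t], of A]]
      C2_on_cmult[OF C2_on_norm_square[of "ball x s" x0], of "- b"]]
      C2_on_cmult[OF C2_on_subset[OF C2 s(2)], of "- k"], folded \<phi>_def]
  define H where "H = (\<lambda>y v. 0 + A *\<^sub>R ((2 * (e \<bullet> v)) *\<^sub>R e) + (- b) *\<^sub>R (2 *\<^sub>R v) + (- k) *\<^sub>R HW y v)"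
  have "\<phi> x = u x" by (simp add: \<phi>_def c'_def \<psi> Wx)
  moreover have "\<phi> y \<le> u y" if y: "y \<in> ball x s" for y
  proof -
    have "k * ?w y \<le> k * W y" using Wge[of y] y s k by (intro mult_left_mono) blast+
    moreover have "c' \<le> u y + k * ?w y - \<psi> y" using touch y s unfolding c'_def by blast
    ultimately show ?thesis by (simp add: \<phi>_def \<psi>)
  qed
  ultimately have le: "weight Psi a x * pucci_minus lam Lam (H x) \<le> f x"
    using visc C2\<phi>[folded H_def] s \<rho> x unfolding visc_super_def by (meson order_trans)
  have "2 * A * lam - 2 * b * Lam * ?d - 2 * N * Lam * ?d * k \<le> pucci_minus lam Lam (H x)"
  proof (rule pucci_minus_ge[OF lam, where P = "\<lambda>v. 2 * A * (e \<bullet> v)\<^sup>2 + k * P v" and Q = "\<lambda>v. 2 * b * (norm v)\<^sup>2 + k * Q v"])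
    show "linear (H x)"
      using lin unfolding H_def
      by (intro linearI) (simp_all add: linear_add linear_cmul inner_add_right algebra_simps)
    show "v \<bullet> H x y = H x v \<bullet> y" for v y
      using sym by (simp add: H_def inner_add_left inner_add_right inner_commute inner_diff_left inner_diff_right)
    show "v \<bullet> H x v = 2 * A * (e \<bullet> v)\<^sup>2 + k * P v - (2 * b * (norm v)\<^sup>2 + k * Q v)" for v
      by (simp add: H_def inner_add_right inner_diff_right PQ(1) dot_square_norm inner_commute power2_eq_square algebra_simps)
  next
    fix S :: "('m \<times> real) set" assume S: "orthonormal_basis S"
    have 1: "(\<Sum>v\<in>S. 2 * A * (e \<bullet> v)\<^sup>2 + k * P v) = 2 * A + k * (\<Sum>v\<in>S. P v)"
      using orthonormal_basis_parseval[OF S, of e] e by (simp add: sum.distrib flip: sum_distrib_left)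
    have 2: "(\<Sum>v\<in>S. 2 * b * (norm v)\<^sup>2 + k * Q v) = 2 * b * ?d + k * (\<Sum>v\<in>S. Q v)"
      using orthonormal_basis_sum_norm_square[OF S] by (simp add: sum.distrib flip: sum_distrib_left)
    have "k * - (2 * N * Lam * ?d) \<le> k * (lam * (\<Sum>v\<in>S. P v) - Lam * (\<Sum>v\<in>S. Q v))"
      using PQsum[OF S] k by (rule mult_left_mono)
    then show "2 * A * lam - 2 * b * Lam * ?d - 2 * N * Lam * ?d * k
      \<le> lam * (\<Sum>v\<in>S. 2 * A * (e \<bullet> v)\<^sup>2 + k * P v) - Lam * (\<Sum>v\<in>S. 2 * b * (norm v)\<^sup>2 + k * Q v)"
      unfolding 1 2 by (simp add: algebra_simps)
  qed (use A b k PQ in auto)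
  then have "weight Psi a x * (2 * A * lam - 2 * b * Lam * ?d - 2 * N * Lam * ?d * k) \<le> weight Psi a x * pucci_minus lam Lam (H x)"
    by (intro mult_left_mono) (auto simp: weight_def)
  then show ?thesis using le by simp
qed

text \<open>Taking \<open>y = x\<close> shows that \<open>z\<close> attains the infimum over the
  parameter at \<open>x\<close>; letting both vary makes \<open>p\<close> a subgradient at
  \<open>x\<close> of that infimum over the closed ball.\<close>

definition contact :: "('m::euclidean_space \<Rightarrow> 'm \<times> real \<Rightarrow> real) \<Rightarrow> 'm \<times> real \<Rightarrow> 'm \<times> real \<Rightarrow> bool" where
  "contact V x p \<longleftrightarrow> x \<in> cball 0 1 \<and>
     (\<exists>z\<in>cball 0 1. \<forall>y\<in>cball 0 1. \<forall>\<zeta>\<in>cball 0 1. V z x + p \<bullet> (y - x) \<le> V \<zeta> y)"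

text \<open>Two affine functions with slopes differing by \<open>q\<close> lying below \<open>V\<close> and touching it at distance
  at most \<open>r\<close> force \<open>V \<ge> \<bar>q\<bar> (s - r)\<^sup>+\<close> modulo the first one. A paraboloid of opening
  \<open>\<bar>q\<bar> / r\<close> then touches from below nearby, which bounds \<open>\<bar>q\<bar> / r\<close> by the right-hand side.\<close>
lemma contact_slopes_close:
  fixes Psi :: "'m::euclidean_space \<Rightarrow> real" and G :: "'m \<Rightarrow> 'm" and u :: "'m \<times> real \<Rightarrow> real"
    and lam Lam \<alpha> B N D k r :: real
  defines "V \<equiv> \<lambda>z y. u y + k * barrier Psi G \<alpha> B N D z y"
  assumes lam: "0 < lam" "lam \<le> Lam" and \<alpha>: "0 < \<alpha>" "\<alpha> < 1" and B: "0 \<le> B" "B \<le> D" and N: "0 \<le> N"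
    and D: "D = Lam * B * (DIM('m \<times> real) + 1) / (lam * \<alpha>)"
    and k: "0 < k"
    and cont: "continuous_on (cball 0 1 \<times> cball 0 1) (\<lambda>(z, y). V z y)"
    and visc: "visc_super lam Lam Psi a \<Omega> f u"
    and \<Omega>: "\<Omega> \<subseteq> ball 0 1" "\<And>y. y \<in> \<Omega> \<Longrightarrow> snd y \<noteq> Psi (fst y)"
    and c0: "contact V x0 p0" and c1: "contact V x1 p1" and x01: "dist x0 x1 \<le> r" and r: "0 < r"
    and ball: "cball x0 (18 * Lam * DIM('m \<times> real) / lam * r) \<subseteq> \<Omega>" and ne: "p1 \<noteq> p0"
  shows "\<exists>y\<in>cball x0 (18 * Lam * DIM('m \<times> real) / lam * r).
     weight Psi a y * (norm (p1 - p0) * lam / (9 * r) - 2 * N * Lam * DIM('m \<times> real) * k) \<le> f y"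
proof -
  let ?d = "real DIM('m \<times> real)"
  \<comment> \<open>Calibration: \<open>\<kappa>\<close> makes the parabola equal to
    \<open>9 * \<kappa> * r\<^sup>2 = norm q * r\<close> on the far face of the slab;
    \<open>b\<close> lets the isotropic correction consume half of the ellipticity,
    \<open>2 * \<kappa> * b * Lam * ?d = \<kappa> * lam\<close>; and \<open>R = 9 / b\<close> with
    \<open>b \<le> 1\<close> gives \<open>b * R\<^sup>2 \<ge> 9\<close>, so the correction beats the
    parabola at distance \<open>R * r\<close>.\<close>
  define R where "R = 18 * Lam * ?d / lam"
  define b where "b = lam / (2 * Lam * ?d)"
  define q where "q = p1 - p0"
  define e where "e = (1 / norm q) *\<^sub>R q"
  define \<kappa> where "\<kappa> = norm q / (9 * r)"
  have q0: "0 < norm q" using ne by (simp add: q_def)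
  have Lam: "0 < Lam" using lam by simp
  have d1: "1 \<le> ?d" by simp
  have b: "0 < b" using lam Lam d1 by (simp add: b_def)
  have b1: "b \<le> 1"
  proof -
    have "lam * 1 \<le> 2 * Lam * ?d" using lam d1 by (intro mult_mono) auto
    then show ?thesis using Lam by (simp add: b_def)
  qed
  have R: "R = 9 / b" using lam Lam by (simp add: R_def b_def field_simps)
  have R0: "0 < R" using b by (simp add: R)
  have bR: "9 \<le> b * R\<^sup>2"
    using b b1 by (simp add: R power2_eq_square field_simps)
  have \<kappa>: "0 < \<kappa>" using q0 r by (simp add: \<kappa>_def)
  have e1: "norm e = 1" using q0 by (simp add: e_def)
  have qe: "q \<bullet> v = norm q * (e \<bullet> v)" for v using q0 by (simp add: e_def)
  have ball': "cball x0 (R * r) \<subseteq> \<Omega>" using ball by (simp add: R_def)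
  obtain z0 where z0: "z0 \<in> cball 0 1" "\<And>y \<zeta>. y \<in> cball 0 1 \<Longrightarrow> \<zeta> \<in> cball 0 1 \<Longrightarrow> V z0 x0 + p0 \<bullet> (y - x0) \<le> V \<zeta> y"
    and x0: "x0 \<in> cball 0 1" using c0 unfolding contact_def by blast
  obtain z1 where z1: "z1 \<in> cball 0 1" "\<And>y \<zeta>. y \<in> cball 0 1 \<Longrightarrow> \<zeta> \<in> cball 0 1 \<Longrightarrow> V z1 x1 + p1 \<bullet> (y - x1) \<le> V \<zeta> y"
    and x1: "x1 \<in> cball 0 1" using c1 unfolding contact_def by blast
  define l where "l y = V z0 x0 + p0 \<bullet> (y - x0)" for y
  have Vl: "l y \<le> V \<zeta> y" if "y \<in> cball 0 1" "\<zeta> \<in> cball 0 1" for y \<zeta>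
    using z0 that by (simp add: l_def)
  have Vl': "l y + norm q * (e \<bullet> (y - x0) - r) \<le> V \<zeta> y" if "y \<in> cball 0 1" "\<zeta> \<in> cball 0 1" for y \<zeta>
  proof -
    have "l x1 \<le> V z1 x1" using Vl x1 z1 by blast
    then have "l x1 + p1 \<bullet> (y - x1) \<le> V \<zeta> y" using z1(2)[OF that] by linarith
    moreover have "l x1 + p1 \<bullet> (y - x1) = l y + q \<bullet> (y - x0) - q \<bullet> (x1 - x0)"
      by (simp add: l_def q_def inner_diff_left inner_diff_right)
    moreover have "q \<bullet> (x1 - x0) \<le> norm q * r"
    proof -
      have "q \<bullet> (x1 - x0) \<le> norm q * norm (x1 - x0)" by (rule norm_cauchy_schwarz)
      also have "\<dots> \<le> norm q * r" using x01 by (intro mult_left_mono) (auto simp: dist_norm norm_minus_commute)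
      finally show ?thesis .
    qed
    ultimately show ?thesis by (simp add: qe algebra_simps)
  qed
  define \<psi> where "\<psi> y = (p0 \<bullet> y + (V z0 x0 - p0 \<bullet> x0)) + \<kappa> * (e \<bullet> y + (r - e \<bullet> x0))\<^sup>2 + (- (\<kappa> * b)) * (norm (y - x0))\<^sup>2" for y
  have \<psi>l: "\<psi> y = l y + \<kappa> * (e \<bullet> (y - x0) + r)\<^sup>2 - \<kappa> * b * (norm (y - x0))\<^sup>2" for y
    by (simp add: \<psi>_def l_def inner_diff_right algebra_simps)
  \<comment> \<open>The minimum of \<open>V - \<psi>\<close> is negative, as seen at
    \<open>x0\<close>, and each face of this truncated slab excludes it: at \<open>- r\<close> the
    parabola vanishes, at \<open>2 * r\<close> the second affine function lies above
    \<open>\<psi>\<close>, and on the sphere the correction wins.\<close>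
  define S where "S = cball x0 (R * r) \<inter> {y. - r \<le> e \<bullet> (y - x0)} \<inter> {y. e \<bullet> (y - x0) \<le> 2 * r}"
  define O' where "O' = ball x0 (R * r) \<inter> {y. - r < e \<bullet> (y - x0)} \<inter> {y. e \<bullet> (y - x0) < 2 * r}"
  have S\<Omega>: "S \<subseteq> \<Omega>" using ball' by (auto simp: S_def)
  then have S1: "S \<subseteq> cball 0 1" using \<Omega>(1) by fastforce
  have "compact S" unfolding S_def
    by (intro compact_Int_closed compact_cball closed_Collect_le continuous_intros)
  then have cS: "compact (cball (0::'m) 1 \<times> S)" by (intro compact_Times compact_cball)
  have x0S: "x0 \<in> S" using r R0 by (simp add: S_def)
  have "continuous_on (cball 0 1 \<times> S) (\<lambda>(z, y). V z y - \<psi> y)"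
  proof -
    have "continuous_on (cball 0 1 \<times> S) (\<lambda>(z, y). V z y)"
      using cont S1 by (rule_tac continuous_on_subset) auto
    then have "continuous_on (cball 0 1 \<times> S) (\<lambda>p. (\<lambda>(z, y). V z y) p - \<psi> (snd p))"
      unfolding \<psi>_def by (intro continuous_intros)
    then show ?thesis by (simp add: split_def)
  qed
  then obtain w where w: "w \<in> cball 0 1 \<times> S"
      "\<And>w'. w' \<in> cball 0 1 \<times> S \<Longrightarrow> (\<lambda>(z, y). V z y - \<psi> y) w \<le> (\<lambda>(z, y). V z y - \<psi> y) w'"
    using continuous_attains_inf[OF cS] x0S z0(1) by blast
  obtain \<zeta> y where wz: "w = (\<zeta>, y)" by (cases w)
  have \<zeta>: "\<zeta> \<in> cball 0 1" and y: "y \<in> S"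
    and min: "\<And>\<zeta>' y'. \<zeta>' \<in> cball 0 1 \<Longrightarrow> y' \<in> S \<Longrightarrow> V \<zeta> y - \<psi> y \<le> V \<zeta>' y' - \<psi> y'"
    using w unfolding wz by auto
  have y1: "y \<in> cball 0 1" using y S1 by blast
  have "V \<zeta> y - \<psi> y \<le> V z0 x0 - \<psi> x0" using min z0(1) x0S by blast
  also have "\<dots> = - (\<kappa> * r\<^sup>2)" by (simp add: \<psi>l l_def)
  also have "\<dots> < 0" using \<kappa> r by simp
  finally have neg: "V \<zeta> y < \<psi> y" by simp
  define s where "s = e \<bullet> (y - x0)"
  have s: "- r \<le> s" "s \<le> 2 * r" using y by (auto simp: S_def s_def)
  have \<psi>y: "\<psi> y = l y + \<kappa> * (s + r)\<^sup>2 - \<kappa> * b * (norm (y - x0))\<^sup>2"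
    by (simp add: \<psi>l s_def)
  have bn: "0 \<le> \<kappa> * b * (norm (y - x0))\<^sup>2" using \<kappa> b by simp
  have 1: "s \<noteq> - r"
  proof
    assume "s = - r"
    then have "\<psi> y \<le> l y" using bn by (simp add: \<psi>y)
    then show False using neg Vl[OF y1 \<zeta>] by simp
  qed
  have 2: "s \<noteq> 2 * r"
  proof
    assume s2: "s = 2 * r"
    have "\<kappa> * (s + r)\<^sup>2 = norm q * r"
      using r by (simp add: s2 \<kappa>_def power2_eq_square field_simps)
    then have "\<psi> y \<le> l y + norm q * (s - r)" using bn by (simp add: \<psi>y s2)
    then show False using neg Vl'[OF y1 \<zeta>] by (simp add: s_def)
  qed
  have 3: "norm (y - x0) \<noteq> R * r"
  proof
    assume n: "norm (y - x0) = R * r"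
    have "(s + r)\<^sup>2 \<le> (3 * r)\<^sup>2" using s r by (intro power_mono) auto
    also have "\<dots> = 9 * r\<^sup>2" by (simp add: power_mult_distrib)
    also have "\<dots> \<le> b * R\<^sup>2 * r\<^sup>2" using bR by (intro mult_right_mono) auto
    also have "\<dots> = b * (norm (y - x0))\<^sup>2" by (simp add: n power_mult_distrib)
    finally have "\<kappa> * (s + r)\<^sup>2 \<le> \<kappa> * (b * (norm (y - x0))\<^sup>2)" using \<kappa> by (intro mult_left_mono) auto
    then have "\<psi> y \<le> l y" by (simp add: \<psi>y)
    then show False using neg Vl[OF y1 \<zeta>] by simp
  qed
  have "y \<in> O'"
    using 1 2 3 s y by (auto simp: O'_def S_def s_def dist_norm norm_minus_commute)
  moreover have "open O'"
    unfolding O'_def by (intro open_Int open_ball open_Collect_less continuous_intros)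
  ultimately obtain \<rho> where \<rho>: "0 < \<rho>" "ball y \<rho> \<subseteq> O'" using open_contains_ball by blast
  have O'S: "O' \<subseteq> S" by (auto simp: O'_def S_def)
  have y\<Omega>: "y \<in> \<Omega>" using y S\<Omega> by blast
  have fy: "fst y \<in> cball 0 1"
    using y1 norm_fst_le[of "fst y" "snd y"] by simp
  \<comment> \<open>The parameter was minimised together with the point, so comparison with the base
    point \<open>fst y\<close> shows that the barrier is negative and hence smooth from above at
    \<open>y\<close>.\<close>
  have "V \<zeta> y - \<psi> y \<le> V (fst y) y - \<psi> y" using min fy y by blast
  then have "barrier Psi G \<alpha> B N D \<zeta> y \<le> barrier Psi G \<alpha> B N D (fst y) y"
    using k by (simp add: V_def)
  also have "\<dots> \<le> - \<bar>snd y - Psi (fst y)\<bar>" by (rule barrier_vertical_le[OF B(2)])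
  also have "\<dots> < 0" using \<Omega>(2)[OF y\<Omega>] by simp
  finally have L0: "tangent_height Psi G \<zeta> y \<noteq> 0"
    using barrier_nonneg_on_tangent[of Psi G \<zeta> y B N \<alpha> D] B N \<alpha> by fastforce
  have "weight Psi a y * (2 * \<kappa> * lam - 2 * (\<kappa> * b) * Lam * ?d - 2 * N * Lam * ?d * k) \<le> f y"
  proof (rule visc_super_barrier_test[OF lam \<alpha> B(1) N D L0 visc y\<Omega> \<rho>(1) _ e1 _ _ _ \<psi>_def])
    show "ball y \<rho> \<subseteq> \<Omega>" using \<rho> O'S S\<Omega> by blast
    show "u y + k * barrier Psi G \<alpha> B N D \<zeta> y - \<psi> y \<le> u y' + k * barrier Psi G \<alpha> B N D \<zeta> y' - \<psi> y'"
      if "y' \<in> ball y \<rho>" for y'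
      using min[OF \<zeta>, of y'] that \<rho> O'S unfolding V_def by blast
  qed (use \<kappa> b k in auto)
  moreover have "2 * \<kappa> * lam - 2 * (\<kappa> * b) * Lam * ?d = norm (p1 - p0) * lam / (9 * r)"
  proof -
    have "lam / (2 * Lam * t) * Lam * t = lam / 2" if "0 < t" for t using Lam that by simp
    then have "b * Lam * ?d = lam / 2" using d1 by (simp only: b_def)
    then have "2 * \<kappa> * lam - 2 * (\<kappa> * b) * Lam * ?d = 2 * \<kappa> * lam - 2 * \<kappa> * (lam / 2)"
      by (metis mult.assoc)
    then show ?thesis by (simp add: \<kappa>_def q_def)
  qed
  moreover have "y \<in> cball x0 (18 * Lam * ?d / lam * r)" using y by (auto simp: S_def R_def)
  ultimately show ?thesis by auto
qed

section \<open>Regularity of the interface and of the barrier\<close>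

lemma holder_gradient_taylor:
  fixes Psi :: "'m::euclidean_space \<Rightarrow> real"
  assumes S: "convex S" "x \<in> S" "z \<in> S"
    and der: "\<And>y. y \<in> S \<Longrightarrow> (Psi has_derivative (\<lambda>h. G y \<bullet> h)) (at y within S)"
    and hol: "\<And>y y'. y \<in> S \<Longrightarrow> y' \<in> S \<Longrightarrow> norm (G y - G y') \<le> K * norm (y - y') powr \<alpha>"
    and K: "0 \<le> K" and \<alpha>: "0 < \<alpha>"
  shows "\<bar>Psi x - Psi z - G z \<bullet> (x - z)\<bar> \<le> K * norm (x - z) powr (1 + \<alpha>)"
proof -
  let ?T = "closed_segment z x"
  have T: "?T \<subseteq> S" using S by (simp add: closed_segment_subset)
  have "norm (Psi x - Psi z - (\<lambda>h. G z \<bullet> h) (x - z)) \<le> norm (x - z) * (K * norm (x - z) powr \<alpha>)"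
  proof (rule differentiable_bound_linearization[where S = ?T and f' = "\<lambda>y h. G y \<bullet> h"])
    show "z + t *\<^sub>R (x - z) \<in> ?T" if "t \<in> {0..1}" for t
      using that by (auto simp: in_segment algebra_simps intro!: exI[of _ t])
    show "(Psi has_derivative (\<lambda>h. G y \<bullet> h)) (at y within ?T)" if "y \<in> ?T" for y
      using der[of y] that T by (meson has_derivative_subset subsetD)
    show "onorm ((\<lambda>h. G y \<bullet> h) - (\<lambda>h. G z \<bullet> h)) \<le> K * norm (x - z) powr \<alpha>" if y: "y \<in> ?T" for y
    proof -
      have "norm (y - z) \<le> norm (x - z)" using segment_bound[OF y] by simp
      then have "K * norm (y - z) powr \<alpha> \<le> K * norm (x - z) powr \<alpha>"
        using K \<alpha> by (intro mult_left_mono powr_mono2) auto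
      then have g: "norm (G y - G z) \<le> K * norm (x - z) powr \<alpha>"
        using hol[of y z] y T S by fastforce
      show ?thesis
      proof (rule onorm_le)
        fix h
        have "norm (((\<lambda>h. G y \<bullet> h) - (\<lambda>h. G z \<bullet> h)) h) = \<bar>(G y - G z) \<bullet> h\<bar>"
          by (simp add: inner_diff_left)
        also have "\<dots> \<le> norm (G y - G z) * norm h" by (rule Cauchy_Schwarz_ineq2)
        also have "\<dots> \<le> (K * norm (x - z) powr \<alpha>) * norm h" using g by (intro mult_right_mono) auto
        finally show "norm (((\<lambda>h. G y \<bullet> h) - (\<lambda>h. G z \<bullet> h)) h) \<le> K * norm (x - z) powr \<alpha> * norm h" .
      qed
    qed
  qed auto
  moreover have "norm (x - z) * (K * norm (x - z) powr \<alpha>) = K * norm (x - z) powr (1 + \<alpha>)"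
    by (cases "norm (x - z) = 0") (auto simp: powr_add)
  ultimately show ?thesis by simp
qed

lemma holder_continuous_on:
  fixes G :: "'m::real_normed_vector \<Rightarrow> 'b::real_normed_vector"
  assumes hol: "\<And>y y'. y \<in> S \<Longrightarrow> y' \<in> S \<Longrightarrow> norm (G y - G y') \<le> K * norm (y - y') powr \<alpha>"
    and \<alpha>: "0 < \<alpha>"
  shows "continuous_on S G"
  unfolding continuous_on_def
proof
  fix x assume x: "x \<in> S"
  have "((\<lambda>y. norm (y - x)) \<longlongrightarrow> 0) (at x within S)"
    by (intro tendsto_eq_intros) auto
  then have "((\<lambda>y. norm (y - x) powr \<alpha>) \<longlongrightarrow> 0) (at x within S)"
    using tendsto_powr'[of "\<lambda>y. norm (y - x)" 0 "at x within S" "\<lambda>_. \<alpha>" \<alpha>] \<alpha> by simp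
  then have "((\<lambda>y. K * norm (y - x) powr \<alpha>) \<longlongrightarrow> 0) (at x within S)"
    using tendsto_mult_right_zero by blast
  then have "((\<lambda>y. G y - G x) \<longlongrightarrow> 0) (at x within S)"
    by (rule Lim_null_comparison[rotated]) (use hol x in \<open>auto simp: eventually_at_filter\<close>)
  then show "(G \<longlongrightarrow> G x) (at x within S)" by (rule LIM_zero_cancel)
qed

lemma fst_in_unit_ball: "y \<in> ball 0 1 \<Longrightarrow> fst y \<in> ball 0 1"
  and fst_in_unit_cball: "y \<in> cball 0 1 \<Longrightarrow> fst y \<in> cball 0 1"
  for y :: "'a::real_normed_vector \<times> 'b::real_normed_vector"
  using norm_fst_le[of "fst y" "snd y"] by auto

text \<open>Joint continuity in parameter and point is what lets the minima below be attained on a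
  compact product.\<close>

lemma barrier_continuous_on:
  fixes Psi :: "'m::euclidean_space \<Rightarrow> real"
  assumes "continuous_on (cball 0 1) Psi" "continuous_on (cball 0 1) G" "-1 < \<alpha>"
  shows "continuous_on (cball 0 1 \<times> X) (\<lambda>(z, y). barrier Psi G \<alpha> B N D z y)"
proof -
  have 1: "continuous_on (cball 0 1 \<times> X) (\<lambda>w. Psi (fst w))" "continuous_on (cball 0 1 \<times> X) (\<lambda>w. G (fst w))"
    by (rule continuous_on_compose2[OF assms(1) continuous_on_fst[OF continuous_on_id]], auto)
      (rule continuous_on_compose2[OF assms(2) continuous_on_fst[OF continuous_on_id]], auto)
  have L: "continuous_on (cball 0 1 \<times> X) (\<lambda>w. tangent_height Psi G (fst w) (snd w))"
    unfolding tangent_height_def by (intro continuous_intros 1)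
  have "continuous_on (cball 0 1 \<times> X) (\<lambda>w. barrier Psi G \<alpha> B N D (fst w) (snd w))"
    unfolding barrier_def using assms(3)
    by (intro continuous_intros L continuous_on_powr') auto
  then show ?thesis by (simp add: split_def)
qed

lemma open_Omega:
  fixes Psi :: "'m::euclidean_space \<Rightarrow> real"
  assumes "continuous_on (ball 0 1) Psi"
  shows "open (Omega_plus Psi)" "open (Omega_minus Psi)"
proof -
  have "continuous_on (ball 0 1) (\<lambda>y::'m \<times> real. Psi (fst y))"
    by (rule continuous_on_compose2[OF assms continuous_on_fst[OF continuous_on_id]])
      (use fst_in_unit_ball in blast)
  then have c: "continuous_on (ball 0 1) (\<lambda>y::'m \<times> real. snd y - Psi (fst y))"
    by (intro continuous_intros)
  have "open ((\<lambda>y::'m \<times> real. snd y - Psi (fst y)) -` {0<..} \<inter> ball 0 1)"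
    by (rule continuous_on_open_vimage[THEN iffD1, rule_format, OF _ c]) auto
  moreover have "(\<lambda>y::'m \<times> real. snd y - Psi (fst y)) -` {0<..} \<inter> ball 0 1 = Omega_plus Psi"
    by (auto simp: Omega_plus_def)
  ultimately show "open (Omega_plus Psi)" by simp
  have "open ((\<lambda>y::'m \<times> real. snd y - Psi (fst y)) -` {..<0} \<inter> ball 0 1)"
    by (rule continuous_on_open_vimage[THEN iffD1, rule_format, OF _ c]) auto
  moreover have "(\<lambda>y::'m \<times> real. snd y - Psi (fst y)) -` {..<0} \<inter> ball 0 1 = Omega_minus Psi"
    by (auto simp: Omega_minus_def)
  ultimately show "open (Omega_minus Psi)" by simp
qed

lemma grad_eqI:
  assumes "(f has_derivative (\<lambda>h. G \<bullet> h)) (at x)"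
  shows "grad f x = G"
  unfolding grad_def
proof (rule the_equality[of "\<lambda>G. (f has_derivative (\<lambda>h. G \<bullet> h)) (at x)", OF assms])
  fix G' assume "(f has_derivative (\<lambda>h. G' \<bullet> h)) (at x)"
  then have "(\<lambda>h. G' \<bullet> h) = (\<lambda>h. G \<bullet> h)" using assms by (rule has_derivative_unique)
  then show "G' = G" by (metis vector_eq_rdot)
qed

text \<open>At \<open>x\<close> the barrier is nonnegative, and at any other \<open>y\<close> the
  parameter \<open>fst y\<close> bounds it by \<open>- \<bar>h y\<bar>\<close>. Contact therefore
  puts \<open>u x + p \<bullet> (y - x) + k * \<bar>h y\<bar>\<close> below \<open>u\<close>, an
  admissible transmission test function because \<open>h\<close> is C^1.\<close>

lemma contact_on_interface:
  fixes Psi :: "'m::euclidean_space \<Rightarrow> real" and G :: "'m \<Rightarrow> 'm" and u :: "'m \<times> real \<Rightarrow> real"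
    and x p :: "'m \<times> real"
  assumes der: "\<And>y. y \<in> cball 0 1 \<Longrightarrow> (Psi has_derivative (\<lambda>h. G y \<bullet> h)) (at y within cball 0 1)"
    and contG: "continuous_on (cball 0 1) G"
    and BD: "B \<le> D" and k: "0 < k"
    and nonneg: "\<And>x z. fst x \<in> cball 0 1 \<Longrightarrow> z \<in> cball 0 1 \<Longrightarrow> snd x = Psi (fst x) \<Longrightarrow> 0 \<le> barrier Psi G \<alpha> B N D z x"
    and visc: "visc_transmission Psi g u" and x: "x \<in> Gamma_if Psi"
    and c: "contact (\<lambda>z y. u y + k * barrier Psi G \<alpha> B N D z y) x p"
  shows "2 * k \<le> g x"
proof -
  let ?w = "barrier Psi G \<alpha> B N D"
  define h where "h y = snd y - Psi (fst y)" for y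
  have x1: "x \<in> ball 0 1" and hx: "h x = 0" using x by (auto simp: Gamma_if_def h_def)
  have vert: "?w (fst y) y \<le> - \<bar>h y\<bar>" for y
    unfolding h_def by (rule barrier_vertical_le[OF BD])
  obtain z where z: "z \<in> cball 0 1"
    and min: "\<And>y \<zeta>. y \<in> cball 0 1 \<Longrightarrow> \<zeta> \<in> cball 0 1 \<Longrightarrow> u x + k * ?w z x + p \<bullet> (y - x) \<le> u y + k * ?w \<zeta> y"
    using c unfolding contact_def by blast
  have "0 \<le> ?w z x" using nonneg[of x z] x1 z fst_in_unit_cball[of x] hx by (simp add: h_def)
  then have zx: "0 \<le> k * ?w z x" using k by simp
  define \<phi> where "\<phi> y = u x + p \<bullet> (y - x) + k * \<bar>h y\<bar>" for y
  define Gp where "Gp y = p + k *\<^sub>R (- G (fst y), 1::real)" for y :: "'m \<times> real"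
  define Gm where "Gm y = p - k *\<^sub>R (- G (fst y), 1::real)" for y :: "'m \<times> real"
  have \<phi>u: "\<phi> y \<le> u y" if "y \<in> ball 0 1" for y
  proof -
    have y: "y \<in> cball 0 1" using that by auto
    have "k * ?w (fst y) y \<le> k * - \<bar>h y\<bar>" using vert k by (intro mult_left_mono) auto
    then show ?thesis
      using min[OF y fst_in_unit_cball[OF y]] zx by (simp add: \<phi>_def)
  qed
  have dPsi: "(Psi has_derivative (\<lambda>v. G y \<bullet> v)) (at y)" if "y \<in> ball 0 1" for y
    using der[of y] that at_within_interior[of y "cball 0 1"] by (simp add: interior_cball)
  have contPsi: "continuous_on (ball 0 1) Psi"
    using dPsi has_derivative_continuous by (metis continuous_at_imp_continuous_on)
  have dh: "(h has_derivative (\<lambda>v. (- G (fst y), 1) \<bullet> v)) (at y within T)" if "y \<in> ball 0 1" for y T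
  proof -
    have "((\<lambda>y. Psi (fst y)) has_derivative (\<lambda>v. G (fst y) \<bullet> fst v)) (at y)"
      using has_derivative_compose[OF has_derivative_fst[OF has_derivative_ident] dPsi[OF fst_in_unit_ball[OF that]]]
      by simp
    then have "(h has_derivative (\<lambda>v. snd v - G (fst y) \<bullet> fst v)) (at y)"
      unfolding h_def by (intro derivative_intros)
    then have "(h has_derivative (\<lambda>v. (- G (fst y), 1) \<bullet> v)) (at y)"
      by (simp add: inner_prod_def)
    then show ?thesis by (rule has_derivative_at_withinI)
  qed
  obtain \<delta> where \<delta>: "0 < \<delta>" "ball x \<delta> \<subseteq> ball 0 1"
    using openE[OF open_ball x1] by blast
  have disj: "Omega_plus Psi \<inter> Omega_minus Psi = {}"
    by (auto simp: Omega_plus_def Omega_minus_def)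
  \<comment> \<open>Inside the ball the opposite side is open and disjoint from this one, so the
    closure keeps the sign of \<open>h\<close> and \<open>\<phi>\<close> is C^1 up to the
    interface.\<close>
  have hp: "0 \<le> h y" if "y \<in> ball x \<delta> \<inter> closure (Omega_plus Psi)" for y
  proof (rule ccontr)
    assume "\<not> 0 \<le> h y"
    then have "y \<in> Omega_minus Psi" using that \<delta> by (auto simp: Omega_minus_def h_def)
    moreover have "Omega_minus Psi \<inter> closure (Omega_plus Psi) = {}"
      using open_Int_closure_eq_empty[OF open_Omega(2)[OF contPsi]] disj by blast
    ultimately show False using that by blast
  qed
  have hm: "h y \<le> 0" if "y \<in> ball x \<delta> \<inter> closure (Omega_minus Psi)" for y
  proof (rule ccontr)
    assume "\<not> h y \<le> 0"
    then have "y \<in> Omega_plus Psi" using that \<delta> by (auto simp: Omega_plus_def h_def)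
    moreover have "Omega_plus Psi \<inter> closure (Omega_minus Psi) = {}"
      using open_Int_closure_eq_empty[OF open_Omega(1)[OF contPsi]] disj by blast
    ultimately show False using that by blast
  qed
  have dp: "(\<phi> has_derivative (\<lambda>v. Gp y \<bullet> v)) (at y within ball x \<delta> \<inter> closure (Omega_plus Psi))"
    if y: "y \<in> ball x \<delta> \<inter> closure (Omega_plus Psi)" for y
  proof (rule has_derivative_transform[OF y])
    show "\<phi> y' = u x + p \<bullet> (y' - x) + k * h y'" if "y' \<in> ball x \<delta> \<inter> closure (Omega_plus Psi)" for y'
      using hp[OF that] by (simp add: \<phi>_def)
    show "((\<lambda>y. u x + p \<bullet> (y - x) + k * h y) has_derivative (\<lambda>v. Gp y \<bullet> v)) (at y within ball x \<delta> \<inter> closure (Omega_plus Psi))"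
      using y \<delta> by (auto intro!: derivative_eq_intros dh simp: Gp_def inner_add_left fun_eq_iff algebra_simps)
  qed
  have dm: "(\<phi> has_derivative (\<lambda>v. Gm y \<bullet> v)) (at y within ball x \<delta> \<inter> closure (Omega_minus Psi))"
    if y: "y \<in> ball x \<delta> \<inter> closure (Omega_minus Psi)" for y
  proof (rule has_derivative_transform[OF y])
    show "\<phi> y' = u x + p \<bullet> (y' - x) - k * h y'" if "y' \<in> ball x \<delta> \<inter> closure (Omega_minus Psi)" for y'
      using hm[OF that] by (simp add: \<phi>_def)
    show "((\<lambda>y. u x + p \<bullet> (y - x) - k * h y) has_derivative (\<lambda>v. Gm y \<bullet> v)) (at y within ball x \<delta> \<inter> closure (Omega_minus Psi))"
      using y \<delta> by (auto intro!: derivative_eq_intros dh simp: Gm_def inner_diff_left fun_eq_iff algebra_simps)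
  qed
  have "continuous_on (ball 0 1) (\<lambda>y::'m \<times> real. G (fst y))"
    by (rule continuous_on_compose2[OF contG continuous_on_fst[OF continuous_on_id]])
      (use fst_in_unit_ball in fastforce)
  then have cG: "continuous_on (ball x \<delta> \<inter> T) (\<lambda>y. G (fst y))" for T
    using \<delta> by (rule_tac continuous_on_subset) auto
  have "Gp x \<bullet> normal_nu Psi x - Gm x \<bullet> normal_nu Psi x \<le> g x"
  proof (rule visc[unfolded visc_transmission_def Let_def, rule_format, OF x, of \<delta> \<phi>], intro conjI ballI)
    show "continuous_on (ball x \<delta> \<inter> closure (Omega_plus Psi)) Gp"
      unfolding Gp_def by (intro continuous_intros cG)
    show "continuous_on (ball x \<delta> \<inter> closure (Omega_minus Psi)) Gm"
      unfolding Gm_def by (intro continuous_intros cG)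
  qed (use \<delta> dp dm \<phi>u hx in \<open>auto simp: \<phi>_def\<close>)
  \<comment> \<open>The gradient \<open>(- G, 1)\<close> of \<open>h\<close> is
    \<open>sqrt (1 + (norm G)\<^sup>2)\<close> times the unit normal, so the jump is at least
    \<open>2 * k\<close>.\<close>
  moreover have "Gp x \<bullet> normal_nu Psi x - Gm x \<bullet> normal_nu Psi x = 2 * k * sqrt (1 + (norm (G (fst x)))\<^sup>2)"
  proof -
    have g: "grad Psi (fst x) = G (fst x)"
      by (rule grad_eqI[OF dPsi[OF fst_in_unit_ball[OF x1]]])
    have t: "(1 + t) / sqrt (1 + t) = sqrt (1 + t)" if "0 \<le> t" for t :: real
      using that by (intro real_div_sqrt) simp
    have "Gp x \<bullet> normal_nu Psi x - Gm x \<bullet> normal_nu Psi x = 2 * k * ((- G (fst x), 1) \<bullet> normal_nu Psi x)"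
      by (simp add: Gp_def Gm_def inner_add_left inner_diff_left del: scaleR_Pair)
    also have "(- G (fst x), 1) \<bullet> normal_nu Psi x = (1 + (norm (G (fst x)))\<^sup>2) / sqrt (1 + (norm (G (fst x)))\<^sup>2)"
      by (simp add: normal_nu_def g power2_norm_eq_inner add_divide_distrib)
    finally show ?thesis by (simp add: t)
  qed
  moreover have "2 * k * 1 \<le> 2 * k * sqrt (1 + (norm (G (fst x)))\<^sup>2)"
    using k by (intro mult_left_mono) auto
  ultimately show ?thesis by linarith
qed

text \<open>Minimise \<open>V\<close> minus the linear function \<open>p\<close>. That function
  oscillates by at most \<open>2 * norm p < \<delta>\<close> on the ball, too little to move the
  minimum to the sphere, where \<open>V\<close> exceeds its value at \<open>x\<close> by at least
  \<open>\<delta>\<close>.\<close>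

lemma contact_exists:
  fixes V :: "'m::euclidean_space \<Rightarrow> 'm \<times> real \<Rightarrow> real"
  assumes cont: "continuous_on (cball 0 1 \<times> cball 0 1) (\<lambda>(z, y). V z y)"
    and bd: "\<And>y \<zeta>. y \<in> sphere 0 1 \<Longrightarrow> \<zeta> \<in> cball 0 1 \<Longrightarrow> - M \<le> V \<zeta> y"
    and x: "x \<in> cball 0 1" "z \<in> cball 0 1" "V z x \<le> - M - \<delta>"
    and p: "norm p < \<delta> / 2"
  shows "\<exists>y\<in>ball 0 1. contact V y p"
proof -
  have cpt: "compact (cball (0::'m) 1 \<times> cball (0::'m \<times> real) 1)"
    by (intro compact_Times compact_cball)
  have "continuous_on (cball 0 1 \<times> cball 0 1) (\<lambda>w. (\<lambda>(z, y). V z y) w - p \<bullet> snd w)"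
    by (intro continuous_intros cont)
  then obtain w where w: "w \<in> cball 0 1 \<times> cball 0 1"
    "\<And>w'. w' \<in> cball 0 1 \<times> cball 0 1 \<Longrightarrow> (\<lambda>(z, y). V z y) w - p \<bullet> snd w \<le> (\<lambda>(z, y). V z y) w' - p \<bullet> snd w'"
    using continuous_attains_inf[OF cpt] x by blast
  obtain \<zeta> y where wz: "w = (\<zeta>, y)" by (cases w)
  have \<zeta>: "\<zeta> \<in> cball 0 1" and y: "y \<in> cball 0 1"
    and min: "\<And>\<zeta>' y'. \<zeta>' \<in> cball 0 1 \<Longrightarrow> y' \<in> cball 0 1 \<Longrightarrow> V \<zeta> y - p \<bullet> y \<le> V \<zeta>' y' - p \<bullet> y'"
    using w unfolding wz by auto
  have pb: "\<bar>p \<bullet> v\<bar> \<le> norm p" if "v \<in> cball 0 1" for v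
  proof -
    have "\<bar>p \<bullet> v\<bar> \<le> norm p * norm v" by (rule Cauchy_Schwarz_ineq2)
    also have "\<dots> \<le> norm p * 1" using that by (intro mult_left_mono) auto
    finally show ?thesis by simp
  qed
  have "y \<notin> sphere 0 1"
  proof
    assume s: "y \<in> sphere 0 1"
    have "V \<zeta> y - p \<bullet> y \<le> V z x - p \<bullet> x" using min x by blast
    then show False using bd[OF s \<zeta>] x(3) pb[OF y] pb[OF x(1)] p by linarith
  qed
  then have "y \<in> ball 0 1" using y by auto
  moreover have "V \<zeta> y + p \<bullet> (y' - y) \<le> V \<zeta>' y'" if "y' \<in> cball 0 1" "\<zeta>' \<in> cball 0 1" for y' \<zeta>'
    using min[OF that(2,1)] by (simp add: inner_diff_right)
  then have "contact V y p"
    unfolding contact_def using \<zeta> y by blast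
  ultimately show ?thesis by blast
qed

section \<open>The maximum principle\<close>

text \<open>\<open>contact_slopes_close\<close> controls slopes by the data at some unspecified
  nearby point; continuity of \<open>F\<close> moves that point to \<open>x\<close> at the cost of a
  factor 2, which turns 9 into 18.\<close>

lemma contact_slopes_locally_close:
  fixes Psi :: "'m::euclidean_space \<Rightarrow> real" and G :: "'m \<Rightarrow> 'm" and u F :: "'m \<times> real \<Rightarrow> real"
    and lam Lam \<alpha> B N D k :: real
  assumes lam: "0 < lam" "lam \<le> Lam" and \<alpha>: "0 < \<alpha>" "\<alpha> < 1" and B: "0 \<le> B" "B \<le> D" and N: "0 \<le> N"
    and D: "D = Lam * B * (DIM('m \<times> real) + 1) / (lam * \<alpha>)"
    and k: "0 < k"
    and cont: "continuous_on (cball 0 1 \<times> cball 0 1) (\<lambda>(z, y). u y + k * barrier Psi G \<alpha> B N D z y)"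
    and visc: "visc_super lam Lam Psi a \<Omega> f u"
    and \<Omega>: "open \<Omega>" "\<Omega> \<subseteq> ball 0 1" "\<And>y. y \<in> \<Omega> \<Longrightarrow> snd y \<noteq> Psi (fst y)"
    and F: "continuous_on \<Omega> F" "\<And>y. y \<in> \<Omega> \<Longrightarrow> 0 < F y"
      "\<And>y. y \<in> \<Omega> \<Longrightarrow> f y / weight Psi a y + 2 * N * Lam * DIM('m \<times> real) * k \<le> F y"
    and x: "x \<in> \<Omega>"
  shows "\<exists>\<delta>>0. \<forall>x0\<in>ball x \<delta>. \<forall>x1\<in>ball x \<delta>. \<forall>p0 p1 r.
        contact (\<lambda>z y. u y + k * barrier Psi G \<alpha> B N D z y) x0 p0 \<longrightarrow>
        contact (\<lambda>z y. u y + k * barrier Psi G \<alpha> B N D z y) x1 p1 \<longrightarrow> dist x0 x1 \<le> r \<longrightarrow> 0 < r \<longrightarrow> r < \<delta>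
        \<longrightarrow> norm (p1 - p0) \<le> (18 / lam) * F x * r"
proof -
  let ?V = "\<lambda>z y. u y + k * barrier Psi G \<alpha> B N D z y"
  define R where "R = 18 * Lam * real DIM('m \<times> real) / lam"
  have R: "0 \<le> R" using lam by (simp add: R_def)
  obtain d1 where d1: "d1 > 0" "ball x d1 \<subseteq> \<Omega>" using openE[OF \<Omega>(1) x] by blast
  have Fx: "0 < F x" using F x by blast
  have "isCont F x" using F \<Omega> x by (simp add: continuous_on_eq_continuous_at)
  then obtain d2 where d2: "d2 > 0" "\<And>y. dist y x < d2 \<Longrightarrow> dist (F y) (F x) < F x"
    using Fx unfolding continuous_at_eps_delta by blast
  \<comment> \<open>Both the offset of \<open>x0\<close> and the enlarged radius
    \<open>R * r\<close> must fit into the ball of radius \<open>min d1 d2\<close>.\<close>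
  define \<delta> where "\<delta> = min d1 d2 / (1 + R)"
  have \<delta>: "0 < \<delta>" using d1 d2 R by (simp add: \<delta>_def)
  have "(1 + R) * \<delta> = min d1 d2" using R by (simp add: \<delta>_def)
  then have \<delta>R: "\<delta> + R * \<delta> = min d1 d2" by (simp add: algebra_simps)
  show ?thesis
  proof (intro exI[of _ \<delta>] conjI \<delta> ballI allI impI)
    fix x0 x1 p0 p1 :: "'m \<times> real" and r :: real
    assume x0: "x0 \<in> ball x \<delta>" and c: "contact ?V x0 p0" "contact ?V x1 p1" and r: "dist x0 x1 \<le> r" "0 < r" "r < \<delta>"
    have sub: "cball x0 (R * r) \<subseteq> ball x (min d1 d2)"
    proof
      fix y assume y: "y \<in> cball x0 (R * r)"
      have "R * r \<le> R * \<delta>" using R r by (intro mult_left_mono) auto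
      then have "dist x y < \<delta> + R * \<delta>"
        using dist_triangle[of x y x0] x0 y by simp
      then show "y \<in> ball x (min d1 d2)" using \<delta>R by simp
    qed
    then have sub\<Omega>: "cball x0 (R * r) \<subseteq> \<Omega>" using d1 by fastforce
    show "norm (p1 - p0) \<le> (18 / lam) * F x * r"
    proof (cases "p1 = p0")
      case True
      then show ?thesis using lam Fx r by simp
    next
      case False
      then obtain y where y: "y \<in> cball x0 (R * r)"
        "weight Psi a y * (norm (p1 - p0) * lam / (9 * r) - 2 * N * Lam * DIM('m \<times> real) * k) \<le> f y"
        using contact_slopes_close[OF lam \<alpha> B N D k cont visc \<Omega>(2,3) c r(1,2)] sub\<Omega>
        unfolding R_def by blast
      have y\<Omega>: "y \<in> \<Omega>" using y sub\<Omega> by blast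
      have w: "0 < weight Psi a y" using \<Omega>(3)[OF y\<Omega>] by (simp add: weight_def)
      have "norm (p1 - p0) * lam / (9 * r) - 2 * N * Lam * DIM('m \<times> real) * k \<le> f y / weight Psi a y"
        using y(2) w by (simp only: pos_le_divide_eq mult.commute)
      then have "norm (p1 - p0) * lam / (9 * r) \<le> F y" using F(3)[OF y\<Omega>] by linarith
      also have "\<dots> \<le> 2 * F x"
      proof -
        have "dist y x < d2" using sub y(1) by (auto simp: dist_commute)
        from d2(2)[OF this] show ?thesis unfolding dist_real_def by linarith
      qed
      finally show ?thesis using lam r by (simp add: field_simps)
    qed
  qed
qed

lemma power_add_le_two_power:
  fixes A B :: real
  assumes "0 \<le> A" "0 \<le> B"
  shows "(A + B) ^ n \<le> 2 ^ n * (A ^ n + B ^ n)"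
proof -
  have "(A + B) ^ n \<le> (2 * max A B) ^ n" using assms by (intro power_mono) auto
  also have "\<dots> = 2 ^ n * max A B ^ n" by (simp add: power_mult_distrib)
  also have "max A B ^ n \<le> A ^ n + B ^ n" using assms by (auto simp: max_def)
  finally show ?thesis by simp
qed

text \<open>Extraction of the d-th root. Each summand is at most a constant times
  \<open>X ^ d\<close>, and the total constant \<open>m \<ge> 1\<close> is enlarged to
  \<open>m ^ d\<close> so that the right side becomes a pure power.\<close>

lemma abp_linear_bound:
  fixes \<delta> ip im k c c2 \<omega> :: real and d :: nat
  assumes d: "0 < d" and pos: "0 \<le> ip" "0 \<le> im" "0 \<le> k" "0 \<le> c" "0 \<le> c2" "0 \<le> \<omega>"
    and le: "(\<delta> / 2) ^ d \<le> (2 * c * d) ^ d * (2 ^ d * (ip + im + (c2 * k) ^ d * \<omega>))"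
  shows "\<delta> \<le> 8 * c * d * (2 + c2 ^ d * \<omega>) * (ip powr (1 / d) + im powr (1 / d) + k)"
proof -
  define X where "X = ip powr (1 / d) + im powr (1 / d) + k"
  define m where "m = 2 + c2 ^ d * \<omega>"
  have X: "0 \<le> X" using pos by (simp add: X_def)
  have m: "1 \<le> m" using pos by (simp add: m_def)
  have root: "i \<le> X ^ d" if "0 \<le> i" "i powr (1 / d) \<le> X" for i
  proof -
    have "i = (i powr (1 / d)) ^ d"
      using d that by (cases "i = 0") (auto simp: powr_realpow[symmetric] powr_powr)
    also have "\<dots> \<le> X ^ d" using that by (intro power_mono) auto
    finally show ?thesis .
  qed
  have "ip powr (1 / d) \<le> X" "im powr (1 / d) \<le> X" using pos by (auto simp: X_def)
  then have "ip \<le> X ^ d" "im \<le> X ^ d" using root pos by blast+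
  moreover have "(c2 * k) ^ d * \<omega> \<le> c2 ^ d * \<omega> * X ^ d"
  proof -
    have "k ^ d \<le> X ^ d" using pos by (intro power_mono) (auto simp: X_def)
    then have "c2 ^ d * \<omega> * k ^ d \<le> c2 ^ d * \<omega> * X ^ d" using pos by (intro mult_left_mono) auto
    then show ?thesis by (simp add: power_mult_distrib algebra_simps)
  qed
  ultimately have "ip + im + (c2 * k) ^ d * \<omega> \<le> m * X ^ d" by (simp add: m_def algebra_simps)
  also have "\<dots> \<le> m ^ d * X ^ d"
    using m d X by (intro mult_right_mono self_le_power) auto
  finally have "(2 * c * d) ^ d * (2 ^ d * (ip + im + (c2 * k) ^ d * \<omega>)) \<le> (2 * c * d) ^ d * (2 ^ d * (m ^ d * X ^ d))"
    using pos by (intro mult_left_mono) auto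
  also have "\<dots> = (4 * c * d * m * X) ^ d"
  proof -
    have "4 * c * d * m * X = (2 * c * d) * (2 * (m * X))" by simp
    then show ?thesis by (simp only: power_mult_distrib)
  qed
  finally have a: "(\<delta> / 2) ^ d \<le> (4 * c * d * m * X) ^ d" using le by linarith
  have "\<delta> / 2 \<le> 4 * c * d * m * X"
  proof (rule ccontr)
    assume n: "\<not> \<delta> / 2 \<le> 4 * c * d * m * X"
    have "0 \<le> 4 * c * d * m * X" using pos m X by simp
    then have "(4 * c * d * m * X) ^ d < (\<delta> / 2) ^ d" using n d by (intro power_strict_mono) auto
    then show False using a by simp
  qed
  then show ?thesis by (simp add: X_def m_def)
qed

text \<open>The ball of slopes of radius \<open>\<delta> / 2\<close> is measured by
  \<open>emeasure_slopes_le\<close> on the union of both sides. The volume of the unit ball occurs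
  as a factor on both sides of the result and cancels.\<close>

lemma abp_slope_measure:
  fixes Psi :: "'m::euclidean_space \<Rightarrow> real" and G :: "'m \<Rightarrow> 'm" and u fp fm :: "'m \<times> real \<Rightarrow> real"
    and lam Lam \<alpha> B N D k :: real
  defines "V \<equiv> \<lambda>z y. u y + k * barrier Psi G \<alpha> B N D z y"
    and "d \<equiv> DIM('m \<times> real)"
  defines "c2 \<equiv> 2 * N * Lam * d + 1"
  assumes lam: "0 < lam" "lam \<le> Lam" and \<alpha>: "0 < \<alpha>" "\<alpha> < 1" and B: "0 \<le> B" "B \<le> D" and N: "0 \<le> N"
    and D: "D = Lam * B * (DIM('m \<times> real) + 1) / (lam * \<alpha>)"
    and k: "0 < k"
    and Psi: "continuous_on (ball 0 1) Psi" and a: "continuous_on (ball 0 1) a"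
    and cont: "continuous_on (cball 0 1 \<times> cball 0 1) (\<lambda>(z, y). V z y)"
    and fp: "continuous_on (Omega_plus Psi) fp" and fm: "continuous_on (Omega_minus Psi) fm"
    and visc: "visc_super lam Lam Psi a (Omega_plus Psi) fp u" "visc_super lam Lam Psi a (Omega_minus Psi) fm u"
    and T: "\<And>p. p \<in> ball 0 (\<delta> / 2) \<Longrightarrow> \<exists>x\<in>Omega_plus Psi \<union> Omega_minus Psi. contact V x p"
    and \<delta>: "0 \<le> \<delta>"
    and fin: "(\<integral>\<^sup>+x. indicator (Omega_plus Psi) x * ennreal (\<bar>max (fp x) 0 / weight Psi a x\<bar> ^ d) \<partial>lborel) = ennreal ip" "0 \<le> ip"
       "(\<integral>\<^sup>+x. indicator (Omega_minus Psi) x * ennreal (\<bar>max (fm x) 0 / weight Psi a x\<bar> ^ d) \<partial>lborel) = ennreal im" "0 \<le> im"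
  shows "(\<delta> / 2) ^ d \<le> (2 * (18 / lam) * d) ^ d * (2 ^ d * (ip + im + (c2 * k) ^ d * unit_ball_vol (real d)))"
proof -
  let ?P = "Omega_plus Psi" and ?M = "Omega_minus Psi" and ?\<omega> = "unit_ball_vol (real d)"
  define Fp where "Fp x = max (fp x) 0 / weight Psi a x" for x
  define Fm where "Fm x = max (fm x) 0 / weight Psi a x" for x
  \<comment> \<open>The summand \<open>1\<close> in \<open>c2\<close> keeps \<open>F\<close>
    positive even where the data vanish and \<open>N = 0\<close>, as the covering argument
    requires.\<close>
  define F where "F x = (if x \<in> ?P then Fp x else Fm x) + c2 * k" for x
  have opn: "open ?P" "open ?M" using open_Omega[OF Psi] by auto
  have disj: "?P \<inter> ?M = {}" by (auto simp: Omega_plus_def Omega_minus_def)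
  have sub: "?P \<subseteq> ball 0 1" "?M \<subseteq> ball 0 1" by (auto simp: Omega_plus_def Omega_minus_def)
  have off: "snd y \<noteq> Psi (fst y)" if "y \<in> ?P \<union> ?M" for y
    using that by (auto simp: Omega_plus_def Omega_minus_def)
  have w: "0 < weight Psi a y" if "y \<in> ?P \<union> ?M" for y
    using off[OF that] by (simp add: weight_def)
  have "continuous_on (ball 0 1) (\<lambda>y::'m \<times> real. Psi (fst y))"
    by (rule continuous_on_compose2[OF Psi continuous_on_fst[OF continuous_on_id]])
      (use fst_in_unit_ball in blast)
  then have cPsi: "continuous_on S (\<lambda>y::'m \<times> real. Psi (fst y))" if "S \<subseteq> ball 0 1" for S
    using that continuous_on_subset by blast
  have cw: "continuous_on ?P (weight Psi a)" "continuous_on ?M (weight Psi a)"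
    unfolding weight_def using off a sub
    by (intro continuous_on_powr continuous_intros cPsi; force intro: continuous_on_subset)+
  have cF: "continuous_on ?P Fp" "continuous_on ?M Fm"
    unfolding Fp_def Fm_def using w by (intro continuous_intros fp fm cw; force)+
  have F0: "0 \<le> Fp y" "0 \<le> Fm y" for y by (simp_all add: Fp_def Fm_def weight_def)
  have c2: "1 \<le> c2" using N lam by (simp add: c2_def)
  have c2k: "0 < c2 * k" using c2 k by simp
  have Fpos: "0 < F y" for y using add_nonneg_pos[OF F0(1)[of y] c2k] add_nonneg_pos[OF F0(2)[of y] c2k] by (simp add: F_def)
  have FP: "continuous_on ?P F"
    by (rule continuous_on_eq[of _ "\<lambda>y. Fp y + c2 * k"]) (auto simp: F_def intro!: continuous_intros cF)
  have FM: "continuous_on ?M F"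
    by (rule continuous_on_eq[of _ "\<lambda>y. Fm y + c2 * k"]) (use disj in \<open>auto simp: F_def intro!: continuous_intros cF\<close>)
  have quot: "t / weight Psi a y + 2 * N * Lam * d * k \<le> max t 0 / weight Psi a y + c2 * k" for t y
  proof -
    have "t / weight Psi a y \<le> max t 0 / weight Psi a y"
      by (intro divide_right_mono) (auto simp: weight_def)
    then show ?thesis using k by (simp add: c2_def algebra_simps)
  qed
  have gp: "fp y / weight Psi a y + 2 * N * Lam * d * k \<le> F y" if "y \<in> ?P" for y
    using quot[of "fp y" y] that by (simp add: F_def Fp_def)
  have gm: "fm y / weight Psi a y + 2 * N * Lam * d * k \<le> F y" if "y \<in> ?M" for y
    using quot[of "fm y" y] that disj by (auto simp: F_def Fm_def)
  let ?U = "?P \<union> ?M"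
  have "emeasure lborel (ball (0::'m \<times> real) (\<delta> / 2))
    \<le> (\<integral>\<^sup>+x. indicator ?U x * ennreal (?\<omega> * (2 * (18 / lam) * d) ^ d * F x ^ d) \<partial>lborel)"
    unfolding d_def
  proof (rule emeasure_slopes_le[where contact = "contact V"])
    show "open ?U" using opn by blast
    show "?U \<subseteq> cbox (- One) One"
    proof
      fix y assume "y \<in> ?U"
      then have "norm y \<le> 1" using sub by auto
      then show "y \<in> cbox (- One) One"
        unfolding mem_box using Basis_le_norm[of _ y] by (fastforce simp: abs_le_iff)
    qed
    show "continuous_on ?U F" by (intro continuous_on_open_Un opn FP FM)
    show "\<exists>\<delta>>0. \<forall>x0\<in>ball x \<delta>. \<forall>x1\<in>ball x \<delta>. \<forall>p0 p1 r. contact V x0 p0 \<longrightarrow> contact V x1 p1 \<longrightarrow>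
        dist x0 x1 \<le> r \<longrightarrow> 0 < r \<longrightarrow> r < \<delta> \<longrightarrow> norm (p1 - p0) \<le> 18 / lam * F x * r" if x: "x \<in> ?U" for x
    proof (cases "x \<in> ?P")
      case True
      show ?thesis
        unfolding V_def
        by (rule contact_slopes_locally_close[OF lam \<alpha> B N D k cont[unfolded V_def] visc(1) opn(1) sub(1) off FP Fpos gp[unfolded d_def] True]) auto
    next
      case False
      then have xM: "x \<in> ?M" using x by blast
      show ?thesis
        unfolding V_def
        by (rule contact_slopes_locally_close[OF lam \<alpha> B N D k cont[unfolded V_def] visc(2) opn(2) sub(2) off FM Fpos gm[unfolded d_def] xM]) auto
    qed
  qed (use lam Fpos T in auto)
  also have "\<dots> \<le> (\<integral>\<^sup>+x. ennreal (?\<omega> * (2 * (18 / lam) * d) ^ d * 2 ^ d) *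
      (indicator ?P x * ennreal (\<bar>Fp x\<bar> ^ d) + indicator ?M x * ennreal (\<bar>Fm x\<bar> ^ d) + ennreal ((c2 * k) ^ d) * indicator (ball 0 1) x) \<partial>lborel)"
  proof (intro nn_integral_mono)
    fix x :: "'m \<times> real"
    let ?c = "?\<omega> * (2 * (18 / lam) * d) ^ d"
    have c: "0 \<le> ?c" using lam by simp
    have est: "ennreal (?c * F x ^ d) \<le> ennreal (?c * 2 ^ d) * (ennreal (\<bar>E\<bar> ^ d) + ennreal ((c2 * k) ^ d))"
      if "F x = E + c2 * k" "0 \<le> E" for E
    proof -
      have "F x ^ d \<le> 2 ^ d * (E ^ d + (c2 * k) ^ d)"
        unfolding that(1) using that(2) c2k by (intro power_add_le_two_power) auto
      then have "?c * F x ^ d \<le> ?c * (2 ^ d * (E ^ d + (c2 * k) ^ d))"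
        using c by (rule mult_left_mono)
      then have "ennreal (?c * F x ^ d) \<le> ennreal (?c * 2 ^ d * (E ^ d + (c2 * k) ^ d))"
        by (intro ennreal_leI) (simp add: mult.assoc)
      also have "\<dots> = ennreal (?c * 2 ^ d) * (ennreal (\<bar>E\<bar> ^ d) + ennreal ((c2 * k) ^ d))"
        using c c2k that by (simp add: ennreal_mult ennreal_plus)
      finally show ?thesis .
    qed
    consider "x \<in> ?P" "x \<notin> ?M" "x \<in> ball 0 1" | "x \<in> ?M" "x \<notin> ?P" "x \<in> ball 0 1" | "x \<notin> ?U"
      using disj sub by blast
    then show "indicator ?U x * ennreal (?c * F x ^ d) \<le> ennreal (?c * 2 ^ d) *
      (indicator ?P x * ennreal (\<bar>Fp x\<bar> ^ d) + indicator ?M x * ennreal (\<bar>Fm x\<bar> ^ d) + ennreal ((c2 * k) ^ d) * indicator (ball 0 1) x)"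
    proof cases
      case 1
      then show ?thesis using est[of "Fp x"] F0 by (simp add: F_def)
    next
      case 2
      then show ?thesis using est[of "Fm x"] F0 by (simp add: F_def)
    qed simp
  qed
  also have "\<dots> = ennreal (?\<omega> * (2 * (18 / lam) * d) ^ d * 2 ^ d) * (ennreal ip + ennreal im + ennreal ((c2 * k) ^ d) * ennreal ?\<omega>)"
  proof -
    have m: "(\<lambda>x. indicator S x * ennreal (\<bar>h x\<bar> ^ d)) \<in> borel_measurable lborel"
      if S: "open S" "continuous_on S h" for S :: "('m \<times> real) set" and h :: "'m \<times> real \<Rightarrow> real"
    proof -
      have "(\<lambda>x. indicator S x *\<^sub>R (\<bar>h x\<bar> ^ d)) \<in> borel_measurable borel"
        using S by (intro borel_measurable_continuous_on_indicator continuous_intros) auto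
      then have "(\<lambda>x. ennreal (indicator S x *\<^sub>R (\<bar>h x\<bar> ^ d))) \<in> borel_measurable borel" by measurable
      moreover have "(\<lambda>x. ennreal (indicator S x *\<^sub>R (\<bar>h x\<bar> ^ d))) = (\<lambda>x. indicator S x * ennreal (\<bar>h x\<bar> ^ d))"
        by (simp add: fun_eq_iff indicator_def)
      ultimately have "(\<lambda>x. indicator S x * ennreal (\<bar>h x\<bar> ^ d)) \<in> borel_measurable borel"
        by (simp only:)
      then show ?thesis by simp
    qed
    note mp = m[OF opn(1) cF(1)] and mm = m[OF opn(2) cF(2)]
    have gen: "(\<integral>\<^sup>+x. c * (f x + h x + e * indicator (ball 0 1) x) \<partial>lborel)
        = c * (integral\<^sup>N lborel f + integral\<^sup>N lborel h + e * ennreal ?\<omega>)"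
      if f: "f \<in> borel_measurable lborel" and h: "h \<in> borel_measurable lborel"
      for f h :: "'m \<times> real \<Rightarrow> ennreal" and c e
    proof -
      have i: "(\<lambda>x::'m \<times> real. e * indicator (ball 0 1) x) \<in> borel_measurable lborel"
        by (intro borel_measurable_times_ennreal borel_measurable_const borel_measurable_indicator) auto
      have fh: "(\<lambda>x. f x + h x) \<in> borel_measurable lborel" using f h by (rule borel_measurable_add)
      have "emeasure lborel (ball (0::'m \<times> real) 1) = ennreal ?\<omega>"
        by (simp add: emeasure_ball d_def)
      then have "(\<integral>\<^sup>+(x::'m \<times> real). e * indicator (ball 0 1) x \<partial>lborel) = e * ennreal ?\<omega>"
        by (subst nn_integral_cmult_indicator) simp_all
      then show ?thesis
        using nn_integral_cmult[OF borel_measurable_add[OF fh i], of c] nn_integral_add[OF fh i] nn_integral_add[OF f h]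
        by simp
    qed
    show ?thesis
      by (subst gen[OF mp mm]) (simp only: fin(1,3) Fp_def Fm_def)
  qed
  also have "emeasure lborel (ball (0::'m \<times> real) (\<delta> / 2)) = ennreal (?\<omega> * (\<delta> / 2) ^ d)"
    using \<delta> by (simp add: emeasure_ball d_def)
  also have "ennreal (?\<omega> * (2 * (18 / lam) * d) ^ d * 2 ^ d) * (ennreal ip + ennreal im + ennreal ((c2 * k) ^ d) * ennreal ?\<omega>)
     = ennreal (?\<omega> * (2 * (18 / lam) * d) ^ d * 2 ^ d * (ip + im + (c2 * k) ^ d * ?\<omega>))"
    using fin c2k lam by (simp add: ennreal_mult ennreal_plus)
  finally have "?\<omega> * (\<delta> / 2) ^ d \<le> ?\<omega> * (2 * (18 / lam) * d) ^ d * 2 ^ d * (ip + im + (c2 * k) ^ d * ?\<omega>)"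
    using fin c2k lam by (subst (asm) ennreal_le_iff) (auto intro!: mult_nonneg_nonneg add_nonneg_nonneg)
  then have "?\<omega> * (\<delta> / 2) ^ d \<le> ?\<omega> * ((2 * (18 / lam) * d) ^ d * (2 ^ d * (ip + im + (c2 * k) ^ d * ?\<omega>)))"
    by (simp only: mult.assoc)
  moreover have "0 < ?\<omega>" by (simp add: d_def)
  ultimately show ?thesis by (simp only: mult_le_cancel_left_pos)
qed

text \<open>The barrier argument needs \<open>k > 0\<close>, whereas the supremum of
  \<open>g\<^sub>+\<close> may be zero; the estimate is proved for every larger \<open>k\<close> and
  then passed to the limit.\<close>

lemma le_at_threshold:
  fixes A E t y :: real
  assumes "0 \<le> E" "\<And>k. t < k \<Longrightarrow> y \<le> A + E * k"
  shows "y \<le> A + E * t"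
proof (rule field_le_epsilon)
  fix e :: real assume e: "0 < e"
  have "y \<le> A + E * (t + e / (E + 1))" using assms e by (intro assms(2)) (simp add: field_simps)
  also have "E * (e / (E + 1)) \<le> e" using assms(1) e by (simp add: field_simps)
  then have "A + E * (t + e / (E + 1)) \<le> A + E * t + e" by (simp add: algebra_simps)
  finally show "y \<le> A + E * t + e" .
qed

theorem mainTheorem4:
  fixes lam Lam \<alpha>0 :: real
    and Psi :: "'m::euclidean_space \<Rightarrow> real"
    and a :: "'m \<times> real \<Rightarrow> real"
  assumes "0 < lam" "lam \<le> Lam"
    and "0 < \<alpha>0" "\<alpha>0 < 1"
    and "C1alpha \<alpha>0 (cball 0 1) Psi"
    and "continuous_on (ball 0 1) a"
    and "\<forall>x\<in>ball 0 1. 0 \<le> a x"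
    and "\<exists>\<theta><1. \<forall>x\<in>ball 0 1. a x \<le> \<theta>"
  shows "\<exists>C. \<forall>(u :: 'm \<times> real \<Rightarrow> real) fp fm g.
      continuous_on (cball 0 1) u \<and>
      continuous_on (Omega_plus Psi) fp \<and> bounded (fp ` Omega_plus Psi) \<and>
      continuous_on (Omega_minus Psi) fm \<and> bounded (fm ` Omega_minus Psi) \<and>
      bounded (g ` Gamma_if Psi) \<and>
      visc_super lam Lam Psi a (Omega_plus Psi) fp u \<and>
      visc_super lam Lam Psi a (Omega_minus Psi) fm u \<and>
      visc_transmission Psi g u
      \<longrightarrow> ennreal (Sup ((\<lambda>x. max (- u x) 0) ` ball 0 1))
          \<le> ennreal (Sup ((\<lambda>x. max (- u x) 0) ` sphere 0 1))
            + ennreal C * (ennreal (Sup (insert 0 ((\<lambda>x. max (g x) 0) ` Gamma_if Psi)))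
                + Ld_omega_norm Psi a (Omega_minus Psi) (\<lambda>x. max (fm x) 0)
                + Ld_omega_norm Psi a (Omega_plus Psi) (\<lambda>x. max (fp x) 0))"
proof -
  note lam = assms(1,2) and \<alpha> = assms(3,4)
  define d where "d = DIM('m \<times> real)"
  obtain G K0 where der: "\<And>y. y \<in> cball 0 1 \<Longrightarrow> (Psi has_derivative (\<lambda>h. G y \<bullet> h)) (at y within cball 0 1)"
    and hol0: "\<And>y y'. y \<in> cball 0 1 \<Longrightarrow> y' \<in> cball 0 1 \<Longrightarrow> norm (G y - G y') \<le> K0 * norm (y - y') powr \<alpha>0"
    using assms(5) unfolding C1alpha_def by blast
  define K where "K = \<bar>K0\<bar>"
  have hol: "norm (G y - G y') \<le> K * norm (y - y') powr \<alpha>0" if "y \<in> cball 0 1" "y' \<in> cball 0 1" for y y'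
    using hol0[OF that] mult_right_mono[OF abs_ge_self, of "norm (y - y') powr \<alpha>0" K0] by (simp add: K_def)
  have K: "0 \<le> K" by (simp add: K_def)
  have contG: "continuous_on (cball 0 1) G" by (rule holder_continuous_on[OF hol \<alpha>(1)])
  have contPsi: "continuous_on (cball 0 1) Psi" by (rule has_derivative_continuous_on[OF der])
  have contPsi': "continuous_on (ball 0 1) Psi"
    by (rule continuous_on_subset[OF contPsi ball_subset_cball])
  have taylor: "\<bar>Psi x - Psi z - G z \<bullet> (x - z)\<bar> \<le> K * norm (x - z) powr (1 + \<alpha>0)"
    if "x \<in> cball 0 1" "z \<in> cball 0 1" for x z
    by (rule holder_gradient_taylor[OF convex_cball that der hol K \<alpha>(1)])
  define B where "B = K + 1"
  define D where "D = Lam * B * (DIM('m \<times> real) + 1) / (lam * \<alpha>0)"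
  have B: "0 \<le> B" using K by (simp add: B_def)
  have "B \<le> D"
  proof -
    have "B * (lam * \<alpha>0) \<le> B * (Lam * (real DIM('m \<times> real) + 1))"
      using lam \<alpha> B by (intro mult_left_mono mult_mono) auto
    then show ?thesis using lam \<alpha> by (simp add: D_def pos_le_divide_eq algebra_simps)
  qed
  note B = B this
  have D0: "0 \<le> D" using B by linarith
  obtain N where N: "0 \<le> N"
    and nonneg: "\<And>x z. fst x \<in> cball 0 1 \<Longrightarrow> z \<in> cball 0 1 \<Longrightarrow> snd x = Psi (fst x) \<Longrightarrow> 0 \<le> barrier Psi G \<alpha>0 B N D z x"
    using barrier_nonneg_on_graph[OF \<alpha>(1) K D0 taylor] unfolding B_def by blast
  let ?w = "barrier Psi G \<alpha>0 B N D"
  have contw: "continuous_on (cball 0 1 \<times> cball 0 1) (\<lambda>(z, y). ?w z y)"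
    using contPsi contG \<alpha> by (intro barrier_continuous_on) auto
  have "compact (cball (0::'m) 1 \<times> cball (0::'m \<times> real) 1)"
    by (intro compact_Times compact_cball)
  then have "compact ((\<lambda>(z, y). ?w z y) ` (cball 0 1 \<times> cball 0 1))"
    using contw by (rule compact_continuous_image[rotated])
  then have "bounded ((\<lambda>(z, y). ?w z y) ` (cball 0 1 \<times> cball 0 1))"
    by (rule compact_imp_bounded)
  \<comment> \<open>\<open>Cw\<close> measures how far the barrier can lower the boundary values. It
    adds to the constant \<open>C3\<close> of the measure estimate, and both are fixed before
    \<open>u\<close> and the data.\<close>
  then obtain Cw where Cw: "0 < Cw" "\<And>z y. z \<in> cball 0 1 \<Longrightarrow> y \<in> cball 0 1 \<Longrightarrow> \<bar>?w z y\<bar> \<le> Cw"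
    unfolding bounded_pos by fastforce
  define c2 where "c2 = 2 * N * Lam * real d + 1"
  define C3 where "C3 = 8 * (18 / lam) * d * (2 + c2 ^ d * unit_ball_vol (real d))"
  have c2: "0 \<le> c2" using N lam by (simp add: c2_def)
  have C3: "0 \<le> C3" using lam c2 by (simp add: C3_def)
  define C where "C = Cw + C3"
  have C: "0 < C" using Cw C3 by (simp add: C_def)
  show ?thesis
  proof (intro exI[of _ C] allI impI, elim conjE)
    fix u fp fm g :: "'m \<times> real \<Rightarrow> real"
    assume u: "continuous_on (cball 0 1) u"
      and fp: "continuous_on (Omega_plus Psi) fp" and fm: "continuous_on (Omega_minus Psi) fm"
      and g: "bounded (g ` Gamma_if Psi)"
      and vp: "visc_super lam Lam Psi a (Omega_plus Psi) fp u"
      and vm: "visc_super lam Lam Psi a (Omega_minus Psi) fm u"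
      and vt: "visc_transmission Psi g u"
    define m where "m = Sup ((\<lambda>x. max (- u x) 0) ` sphere 0 1)"
    define gs where "gs = Sup (insert 0 ((\<lambda>x. max (g x) 0) ` Gamma_if Psi))"
    define Ip where "Ip = (\<integral>\<^sup>+x. indicator (Omega_plus Psi) x * ennreal (\<bar>max (fp x) 0 / weight Psi a x\<bar> ^ d) \<partial>lborel)"
    define Im where "Im = (\<integral>\<^sup>+x. indicator (Omega_minus Psi) x * ennreal (\<bar>max (fm x) 0 / weight Psi a x\<bar> ^ d) \<partial>lborel)"
    have nP: "Ld_omega_norm Psi a (Omega_plus Psi) (\<lambda>x. max (fp x) 0) = (if Ip = \<infinity> then \<infinity> else ennreal (enn2real Ip powr (1 / real d)))"
      by (simp add: Ld_omega_norm_def Ip_def d_def Let_def)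
    have nM: "Ld_omega_norm Psi a (Omega_minus Psi) (\<lambda>x. max (fm x) 0) = (if Im = \<infinity> then \<infinity> else ennreal (enn2real Im powr (1 / real d)))"
      by (simp add: Ld_omega_norm_def Im_def d_def Let_def)
    have "continuous_on (sphere 0 1) (\<lambda>x. max (- u x) 0)"
      by (intro continuous_intros continuous_on_subset[OF u]) auto
    then have "compact ((\<lambda>x. max (- u x) 0) ` sphere 0 1)"
      by (intro compact_continuous_image compact_sphere)
    then have bdd: "bdd_above ((\<lambda>x. max (- u x) 0) ` sphere 0 1)"
      by (intro bounded_imp_bdd_above compact_imp_bounded)
    have m: "max (- u y) 0 \<le> m" if "y \<in> sphere 0 1" for y
      unfolding m_def using that by (intro cSup_upper[OF _ bdd]) auto
    have "(0, 1) \<in> sphere (0::'m \<times> real) 1" by (simp add: norm_Pair)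
    then have m0: "0 \<le> m" using m by fastforce
    obtain b where b: "\<And>x. x \<in> Gamma_if Psi \<Longrightarrow> \<bar>g x\<bar> \<le> b"
      using g unfolding bounded_iff by auto
    have bddg: "bdd_above (insert 0 ((\<lambda>x. max (g x) 0) ` Gamma_if Psi))"
      by (rule bdd_aboveI[of _ "max b 0"]) (use b in \<open>fastforce simp: abs_le_iff max_def\<close>)
    have gs: "g x \<le> gs" if "x \<in> Gamma_if Psi" for x
    proof -
      have "max (g x) 0 \<le> gs" unfolding gs_def using that by (intro cSup_upper[OF _ bddg]) auto
      then show ?thesis by simp
    qed
    have gs0: "0 \<le> gs" unfolding gs_def by (intro cSup_upper[OF _ bddg]) auto
    have "ennreal (Sup ((\<lambda>x. max (- u x) 0) ` ball 0 1)) \<le> ennreal m + ennreal C * (ennreal gs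
                + Ld_omega_norm Psi a (Omega_minus Psi) (\<lambda>x. max (fm x) 0)
                + Ld_omega_norm Psi a (Omega_plus Psi) (\<lambda>x. max (fp x) 0))"
    proof (cases "Ip = \<infinity> \<or> Im = \<infinity>")
      case True
      \<comment> \<open>Positivity of \<open>C\<close> makes the right-hand side infinite.\<close>
      then show ?thesis using C by (auto simp: nP nM ennreal_mult_top)
    next
      case False
      define ip where "ip = enn2real Ip"
      define im where "im = enn2real Im"
      have ip: "Ip = ennreal ip" "0 \<le> ip" and im: "Im = ennreal im" "0 \<le> im"
        using False by (auto simp: ip_def im_def top.not_eq_extremum)
      define X where "X = ip powr (1 / d) + im powr (1 / d)"
      have X: "0 \<le> X" by (simp add: X_def)
      have bound: "- u x \<le> (m + C3 * X) + C * k" if k: "gs < k" and x: "x \<in> ball 0 1" for k x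
      proof -
        have k0: "0 < k" using k gs0 by simp
        let ?V = "\<lambda>z y. u y + k * ?w z y"
        \<comment> \<open>The excess of \<open>- u x\<close> over the boundary supremum, after
          deducting what the barrier may cost on the sphere.\<close>
        define \<delta> where "\<delta> = - u x - m - k * Cw"
        have "\<delta> \<le> C3 * (X + k)"
        proof (cases "\<delta> \<le> 0")
          case True
          then show ?thesis using C3 X k0 by (meson add_nonneg_nonneg less_imp_le mult_nonneg_nonneg order_trans)
        next
          case False
          then have \<delta>: "0 \<le> \<delta>" by simp
          have contV: "continuous_on (cball 0 1 \<times> cball 0 1) (\<lambda>(z, y). ?V z y)"
          proof -
            have "continuous_on (cball 0 1 \<times> cball 0 1) (\<lambda>w::'m \<times> 'm \<times> real. u (snd w))"
              by (rule continuous_on_compose2[OF u continuous_on_snd[OF continuous_on_id]]) auto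
            then have "continuous_on (cball 0 1 \<times> cball 0 1) (\<lambda>w. u (snd w) + k * (\<lambda>(z, y). ?w z y) w)"
              by (intro continuous_intros contw)
            then show ?thesis by (simp add: split_def)
          qed
          have T: "\<exists>y\<in>Omega_plus Psi \<union> Omega_minus Psi. contact ?V y p" if p: "p \<in> ball 0 (\<delta> / 2)" for p
          proof -
            have "\<exists>y\<in>ball 0 1. contact ?V y p"
            proof (rule contact_exists[OF contV])
              show "- (m + k * Cw) \<le> ?V \<zeta> y" if "y \<in> sphere 0 1" "\<zeta> \<in> cball 0 1" for y \<zeta>
              proof -
                have "\<bar>?w \<zeta> y\<bar> \<le> Cw" using that by (intro Cw) auto
                then have "k * - Cw \<le> k * ?w \<zeta> y" using k0 by (intro mult_left_mono) auto
                then show ?thesis using m[OF that(1)] by simp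
              qed
              show "x \<in> cball 0 1" "fst x \<in> cball 0 1"
                using x fst_in_unit_cball[of x] by auto
              have "?w (fst x) x \<le> 0" using barrier_vertical_le[OF B(2), of Psi G \<alpha>0 N x] by linarith
              then have "k * ?w (fst x) x \<le> 0" using k0 by (simp add: mult_nonneg_nonpos)
              then show "?V (fst x) x \<le> - (m + k * Cw) - \<delta>" by (simp add: \<delta>_def)
              show "norm p < \<delta> / 2" using p by simp
            qed
            then obtain y where y: "y \<in> ball 0 1" "contact ?V y p" by blast
            have "y \<notin> Gamma_if Psi"
            proof
              assume yG: "y \<in> Gamma_if Psi"
              \<comment> \<open>Contradiction with \<open>g y \<le> gs < k\<close> and
                \<open>k > 0\<close>: no contact point lies on the interface.\<close>
              have "2 * k \<le> g y"
                by (rule contact_on_interface[OF der contG B(2) k0 nonneg vt yG y(2)])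
              then show False using gs[OF yG] k k0 by linarith
            qed
            then have "y \<in> Omega_plus Psi \<union> Omega_minus Psi"
              using y(1) by (auto simp: Gamma_if_def Omega_plus_def Omega_minus_def)
            then show ?thesis using y by blast
          qed
          have "(\<delta> / 2) ^ d \<le> (2 * (18 / lam) * d) ^ d * (2 ^ d * (ip + im + (c2 * k) ^ d * unit_ball_vol (real d)))"
            unfolding c2_def d_def
            by (rule abp_slope_measure[OF lam \<alpha> B N D_def k0 contPsi' assms(6) contV fp fm vp vm T \<delta>])
              (use ip im in \<open>auto simp: Ip_def Im_def d_def\<close>)
          then have "\<delta> \<le> 8 * (18 / lam) * d * (2 + c2 ^ d * unit_ball_vol (real d)) * (ip powr (1 / d) + im powr (1 / d) + k)"
            using ip im k0 c2 lam by (intro abp_linear_bound) (auto simp: d_def)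
          then show ?thesis by (simp add: C3_def X_def)
        qed
        then show ?thesis by (simp add: \<delta>_def C_def algebra_simps)
      qed
      have "- u x \<le> (m + C3 * X) + C * gs" if "x \<in> ball 0 1" for x
        using le_at_threshold[of C gs "- u x" "m + C3 * X"] bound that C by simp
      moreover have "C3 * X \<le> C * X" using X Cw by (intro mult_right_mono) (auto simp: C_def)
      ultimately have ub: "max (- u x) 0 \<le> m + C * (gs + X)" if "x \<in> ball 0 1" for x
        using that m0 C X gs0 by (fastforce simp: algebra_simps)
      have "Sup ((\<lambda>x. max (- u x) 0) ` ball 0 1) \<le> m + C * (gs + X)"
        by (rule cSup_least) (use ub in auto)
      then have "ennreal (Sup ((\<lambda>x. max (- u x) 0) ` ball 0 1)) \<le> ennreal (m + C * (gs + X))"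
        by (rule ennreal_leI)
      also have "\<dots> = ennreal m + ennreal C * (ennreal gs + ennreal (im powr (1 / d)) + ennreal (ip powr (1 / d)))"
        using m0 C gs0 X by (simp add: X_def ennreal_plus ennreal_mult add.assoc add.commute[of "ip powr (1 / d)"])
      finally show ?thesis using False by (simp add: nP nM ip_def im_def)
    qed
    then show "ennreal (Sup ((\<lambda>x. max (- u x) 0) ` ball 0 1))
          \<le> ennreal (Sup ((\<lambda>x. max (- u x) 0) ` sphere 0 1))
            + ennreal C * (ennreal (Sup (insert 0 ((\<lambda>x. max (g x) 0) ` Gamma_if Psi)))
                + Ld_omega_norm Psi a (Omega_minus Psi) (\<lambda>x. max (fm x) 0)
                + Ld_omega_norm Psi a (Omega_plus Psi) (\<lambda>x. max (fp x) 0))"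
      by (simp only: m_def gs_def)
  qed
qed

end
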